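(* There is a nonempty set $A\subseteq\omega$ of quasiminimal enumeration degree such that $\mathcal E_A$ is Medvedev equivalent to a compact subset of $\omega^\omega$. Hence $\deg_{\mathrm s}(\mathcal E_A)$ is closed, nonzero, and does not bound any nonzero degree of solvability (i.e., there is no nonrecursive $f\in\omega^\omega$ with $\{f\}\leq_{\mathrm s}\mathcal E_A$).
   Context: $\mathcal E_A=\{f\in\omega^\omega:\mathrm{ran}(f)=A\}$. $\mathcal A\leq_{\mathrm s}\mathcal B$ iff there is a Turing functional $\Phi$ with $\Phi(f)$ total and in $\mathcal A$ for all $f\in\mathcal B$; Medvedev equivalence is reducibility both ways; $\deg_{\mathrm s}$ is the equivalence class. A degree is closed if it contains a closed subset of Baire space, and nonzero if its members have no recursive element. A degree of solvability is the degree of a singleton $\{f\}$. A set $A$ is quasiminimal if $A$ is not r.e. and there is no nonrecursive total $g$ with $\mathrm{graph}(g)=\{\langle n,g(n)\rangle:n\in\omega\}\leq_{\mathrm e}A$; $A$ has quasiminimal enumeration degree if it is enumeration equivalent to a quasiminimal set. *)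

theory Defs
  imports "HOL-Analysis.Function_Topology" "HOL-Library.Nat_Bijection"
begin

section \<open>Recursive functions and Turing functionals\<close>

text \<open>
  Kleene's schemata for the partial recursive functions, relativised to an oracle.
\<close>

datatype prog =
    Zero
  | Succ
  | Proj nat
  | Query
  | Comp prog "prog list"
  | PrimRec prog prog
  | Mu prog

text \<open>
  \<open>computes f p xs y\<close>: on input \<open>xs\<close> and with oracle \<open>f\<close> the program \<open>p\<close> converges
  to \<open>y\<close>. As usual, \<open>Mu p\<close> requires \<open>p\<close> to converge on every candidate below the
  least zero.
\<close>

inductive computes :: "(nat \<Rightarrow> nat) \<Rightarrow> prog \<Rightarrow> nat list \<Rightarrow> nat \<Rightarrow> bool" for f :: "nat \<Rightarrow> nat" where
  zero: "computes f Zero xs 0"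
| succ: "computes f Succ [x] (Suc x)"
| proj: "i < length xs \<Longrightarrow> computes f (Proj i) xs (xs ! i)"
| query: "computes f Query [x] (f x)"
| comp: "\<lbrakk>list_all2 (\<lambda>q y. computes f q xs y) qs ys; computes f p ys z\<rbrakk>
    \<Longrightarrow> computes f (Comp p qs) xs z"
| primrec_0: "computes f p xs y \<Longrightarrow> computes f (PrimRec p q) (0 # xs) y"
| primrec_Suc: "\<lbrakk>computes f (PrimRec p q) (n # xs) y; computes f q (n # y # xs) z\<rbrakk>
    \<Longrightarrow> computes f (PrimRec p q) (Suc n # xs) z"
| mu: "\<lbrakk>computes f p (n # xs) 0; \<forall>m<n. \<exists>y>0. computes f p (m # xs) y\<rbrakk>
    \<Longrightarrow> computes f (Mu p) xs n"

inductive_cases computes_ZeroE: "computes f Zero xs z"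
inductive_cases computes_SuccE: "computes f Succ xs z"
inductive_cases computes_ProjE: "computes f (Proj i) xs z"
inductive_cases computes_QueryE: "computes f Query xs z"
inductive_cases computes_CompE: "computes f (Comp p qs) xs z"
inductive_cases computes_PrimRec_0E: "computes f (PrimRec p q) (0 # xs) z"
inductive_cases computes_PrimRec_SucE: "computes f (PrimRec p q) (Suc n # xs) z"
inductive_cases computes_MuE: "computes f (Mu p) xs z"

lemma computes_deterministic:
  "computes f p xs y \<Longrightarrow> computes f p xs z \<Longrightarrow> y = z"
proof (induction arbitrary: z rule: computes.induct)
  case (zero xs)
  then show ?case by (rule computes_ZeroE) simp
next
  case (succ x)
  then show ?case by (rule computes_SuccE) simp
next
  case (proj i xs)
  from proj.prems show ?case by (rule computes_ProjE) simp
next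
  case (query x)
  then show ?case by (rule computes_QueryE) simp
next
  case (comp xs qs ys p z')
  from comp.prems obtain ys' where ys': "list_all2 (\<lambda>q y. computes f q xs y) qs ys'"
    and p: "computes f p ys' z"
    by (rule computes_CompE)
  have "ys = ys'"
  proof (rule nth_equalityI)
    show "length ys = length ys'"
      using list_all2_lengthD[OF comp.IH(1)] list_all2_lengthD[OF ys'] by simp
    show "ys ! i = ys' ! i" if "i < length ys" for i
      using list_all2_nthD2[OF comp.IH(1) that] list_all2_nthD[OF ys', of i]
        list_all2_lengthD[OF comp.IH(1)] that by simp
  qed
  then show ?case using comp.IH(2) p by blast
next
  case (primrec_0 p xs y q)
  from primrec_0.prems have "computes f p xs z" by (rule computes_PrimRec_0E)
  then show ?case by (rule primrec_0.IH)
next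
  case (primrec_Suc p q n xs y z')
  from primrec_Suc.prems obtain y' where y': "computes f (PrimRec p q) (n # xs) y'"
    and "computes f q (n # y' # xs) z"
    by (rule computes_PrimRec_SucE)
  with primrec_Suc.IH(1)[OF y'] show ?case using primrec_Suc.IH(2) by blast
next
  case (mu p n xs)
  from mu.prems have z: "computes f p (z # xs) 0" "\<forall>m<z. \<exists>y>0. computes f p (m # xs) y"
    by (rule computes_MuE, blast)+
  have "\<not> n < z"
    using z(2) mu.IH(1) by blast
  moreover have "\<not> z < n"
    using mu.IH(2) z(1) by blast
  ultimately show ?case by simp
qed

fun oracle_free :: "prog \<Rightarrow> bool" where
  "oracle_free Query = False"
| "oracle_free (Comp p qs) = (oracle_free p \<and> (\<forall>q\<in>set qs. oracle_free q))"
| "oracle_free (PrimRec p q) = (oracle_free p \<and> oracle_free q)"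
| "oracle_free (Mu p) = oracle_free p"
| "oracle_free _ = True"

text \<open>The oracle supplied to an oracle-free program is irrelevant.\<close>

definition recursive :: "(nat \<Rightarrow> nat) \<Rightarrow> bool" where
  "recursive g \<longleftrightarrow> (\<exists>p. oracle_free p \<and> (\<forall>n. computes (\<lambda>_. 0) p [n] (g n)))"

definition re :: "nat set \<Rightarrow> bool" where
  "re A \<longleftrightarrow> A = {} \<or> (\<exists>h. recursive h \<and> range h = A)"


section \<open>Enumeration reducibility\<close>

definition enum_reducible :: "nat set \<Rightarrow> nat set \<Rightarrow> bool"  (infix "\<le>\<^sub>e" 50) where
  "A \<le>\<^sub>e B \<longleftrightarrow>
     (\<exists>W. re W \<and>
       (\<forall>x. x \<in> A \<longleftrightarrow> (\<exists>D. finite D \<and> D \<subseteq> B \<and> prod_encode (x, set_encode D) \<in> W)))"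

definition enum_equivalent :: "nat set \<Rightarrow> nat set \<Rightarrow> bool"  (infix "\<equiv>\<^sub>e" 50) where
  "A \<equiv>\<^sub>e B \<longleftrightarrow> A \<le>\<^sub>e B \<and> B \<le>\<^sub>e A"

definition graph :: "(nat \<Rightarrow> nat) \<Rightarrow> nat set" where
  "graph g = {prod_encode (n, g n) | n. True}"

definition quasiminimal :: "nat set \<Rightarrow> bool" where
  "quasiminimal A \<longleftrightarrow> \<not> re A \<and> \<not> (\<exists>g. \<not> recursive g \<and> graph g \<le>\<^sub>e A)"

definition quasiminimal_enum_degree :: "nat set \<Rightarrow> bool" where
  "quasiminimal_enum_degree A \<longleftrightarrow> (\<exists>B. quasiminimal B \<and> A \<equiv>\<^sub>e B)"


section \<open>Medvedev reducibility\<close>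

text \<open>
  Mass problems are subsets of Baire space \<^typ>\<open>nat \<Rightarrow> nat\<close>, whose library topology is
  the product topology of the discrete topology on \<^typ>\<open>nat\<close>.
\<close>

definition medvedev_reducible :: "(nat \<Rightarrow> nat) set \<Rightarrow> (nat \<Rightarrow> nat) set \<Rightarrow> bool"
    (infix "\<le>\<^sub>s" 50) where
  "\<A> \<le>\<^sub>s \<B> \<longleftrightarrow> (\<exists>\<Phi>. \<forall>f\<in>\<B>. \<exists>g\<in>\<A>. \<forall>n. computes f \<Phi> [n] (g n))"

definition medvedev_equivalent :: "(nat \<Rightarrow> nat) set \<Rightarrow> (nat \<Rightarrow> nat) set \<Rightarrow> bool"
    (infix "\<equiv>\<^sub>s" 50) where
  "\<A> \<equiv>\<^sub>s \<B> \<longleftrightarrow> \<A> \<le>\<^sub>s \<B> \<and> \<B> \<le>\<^sub>s \<A>"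

definition deg\<^sub>s :: "(nat \<Rightarrow> nat) set \<Rightarrow> (nat \<Rightarrow> nat) set set" where
  "deg\<^sub>s \<A> = {\<B>. \<B> \<equiv>\<^sub>s \<A>}"

definition deg_le :: "(nat \<Rightarrow> nat) set set \<Rightarrow> (nat \<Rightarrow> nat) set set \<Rightarrow> bool" where
  "deg_le \<a> \<b> \<longleftrightarrow> (\<exists>\<A>\<in>\<a>. \<exists>\<B>\<in>\<b>. \<A> \<le>\<^sub>s \<B>)"

definition closed_degree :: "(nat \<Rightarrow> nat) set set \<Rightarrow> bool" where
  "closed_degree \<a> \<longleftrightarrow> (\<exists>\<A>\<in>\<a>. closed \<A>)"

definition nonzero_degree :: "(nat \<Rightarrow> nat) set set \<Rightarrow> bool" where
  "nonzero_degree \<a> \<longleftrightarrow> (\<forall>\<A>\<in>\<a>. \<not> (\<exists>f\<in>\<A>. recursive f))"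

definition degree_of_solvability :: "(nat \<Rightarrow> nat) set set \<Rightarrow> bool" where
  "degree_of_solvability \<a> \<longleftrightarrow> (\<exists>f. \<a> = deg\<^sub>s {f})"

definition enumerations :: "nat set \<Rightarrow> (nat \<Rightarrow> nat) set"  ("\<E>") where
  "\<E> A = {f. range f = A}"

end

theory Submission
  imports Defs
begin

text \<open>
  Code the nodes of a tree on \<open>\<omega>\<close> by numbers, so that the entries of a path can themselves be read
  as nodes. The set \<open>A\<close> is a finitely branching tree \<open>T\<close> without dead ends, all of whose paths \<open>x\<close>
  satisfy \<open>range x = T\<close>. Then the compact set of paths of \<open>T\<close> consists of enumerations of \<open>T\<close>, and
  from an enumeration of \<open>T\<close> a path is computed by following children as they appear.

  \<open>T\<close> is built by finite extension. A condition is a finite tree \<open>F\<close> that contains all labels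
  used in it, and whose inner nodes never receive new children; the nodes that may still enter form
  a recursively enumerable set \<open>future F\<close>, every finite subset of which can be added to \<open>F\<close>.
  Given a program, either two computations with oracle values in \<open>future F\<close> disagree, and adding
  these values to \<open>T\<close> prevents the program from reducing a singleton to \<open>\<E> T\<close>; or all of them agree, and
  a function that the program computes from every enumeration of \<open>T\<close> is recursive, by a search through the
  finite sequences in \<open>future F\<close>. Finally \<open>T\<close> is not recursively enumerable: it differs from each
  \<open>future F\<close>, which is infinitely branching, and a set that misses an element of \<open>future F\<close> is
  avoided by adding that element to \<open>T\<close>.
\<close>

section \<open>Oracle programs\<close>

instance prog :: countable by countable_datatype

text \<open>A halting computation asks finitely many oracle questions, and \<open>k\<close> exceeds
  all of them. This replaces enumerations by finite sequences of values.\<close>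

lemma computes_use:
  assumes "computes f p xs y"
  shows "\<exists>k. \<forall>g. (\<forall>i<k. g i = f i) \<longrightarrow> computes g p xs y"
  using assms
proof (induction rule: computes.induct)
  case (query x)
  have "computes g Query [x] (f x)" if "\<forall>i<Suc x. g i = f i" for g
    using computes.query[of g x] that by simp
  then show ?case by blast
next
  case (comp xs qs ys p z)
  have "\<exists>k. \<forall>g. (\<forall>i<k. g i = f i) \<longrightarrow> list_all2 (\<lambda>q y. computes g q xs y) qs ys"
    using comp.IH(1)
  proof (induction rule: list_all2_induct)
    case (Cons q qs y ys)
    then obtain k k' where
      "\<forall>g. (\<forall>i<k. g i = f i) \<longrightarrow> computes g q xs y"
      "\<forall>g. (\<forall>i<k'. g i = f i) \<longrightarrow> list_all2 (\<lambda>q y. computes g q xs y) qs ys" by blast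
    then show ?case by (intro exI[of _ "max k k'"]) auto
  qed simp
  then obtain k k' where
    "\<forall>g. (\<forall>i<k. g i = f i) \<longrightarrow> list_all2 (\<lambda>q y. computes g q xs y) qs ys"
    "\<forall>g. (\<forall>i<k'. g i = f i) \<longrightarrow> computes g p ys z" using comp.IH(2) by blast
  then have "computes g (Comp p qs) xs z" if "\<forall>i<max k k'. g i = f i" for g
    using that by (intro computes.comp[of g xs qs ys]) auto
  then show ?case by blast
next
  case (primrec_Suc p q n xs y z)
  then obtain k k' where
    "\<forall>g. (\<forall>i<k. g i = f i) \<longrightarrow> computes g (PrimRec p q) (n # xs) y"
    "\<forall>g. (\<forall>i<k'. g i = f i) \<longrightarrow> computes g q (n # y # xs) z" by blast
  then have "computes g (PrimRec p q) (Suc n # xs) z" if "\<forall>i<max k k'. g i = f i" for g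
    using that by (intro computes.primrec_Suc[of g p q n xs y]) auto
  then show ?case by blast
next
  case (mu p n xs)
  obtain k where k: "\<forall>g. (\<forall>i<k. g i = f i) \<longrightarrow> computes g p (n # xs) 0"
    using mu.IH(1) by blast
  obtain K where K: "\<forall>m<n. \<exists>y>0. \<forall>g. (\<forall>i<K m. g i = f i) \<longrightarrow> computes g p (m # xs) y"
    using mu.IH(2) by metis
  show ?case
  \<comment> \<open>The sum dominates each \<open>K m\<close> with \<open>m < n\<close>, so one
    bound serves all candidates.\<close>
  proof (intro exI[of _ "k + sum K {..<n}"] allI impI)
    fix g :: "nat \<Rightarrow> nat" assume g: "\<forall>i<k + sum K {..<n}. g i = f i"
    have "K m \<le> sum K {..<n}" if "m < n" for m
      using that member_le_sum[of m "{..<n}" K] by simp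
    then have "\<forall>m<n. \<forall>i<K m. g i = f i" using g by (meson le_add2 le_trans less_le_trans)
    then have "\<forall>m<n. \<exists>y>0. computes g p (m # xs) y" using K by blast
    moreover have "computes g p (n # xs) 0" using k g by auto
    ultimately show "computes g (Mu p) xs n" by (intro computes.mu)
  qed
qed (auto intro: computes.intros)

section \<open>Composition of functionals by substitution for queries\<close>

fun subst_query :: "prog \<Rightarrow> prog \<Rightarrow> prog" where
  "subst_query r Query = r"
| "subst_query r (Comp p qs) = Comp (subst_query r p) (map (subst_query r) qs)"
| "subst_query r (PrimRec p q) = PrimRec (subst_query r p) (subst_query r q)"
| "subst_query r (Mu p) = Mu (subst_query r p)"
| "subst_query r p = p"

lemma computes_subst_query:
  assumes "computes f p xs y" and r: "\<And>n. computes g r [n] (f n)"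
  shows "computes g (subst_query r p) xs y"
  using assms(1)
proof (induction rule: computes.induct)
  case (comp xs qs ys p z)
  have "list_all2 (\<lambda>q y. computes g q xs y) (map (subst_query r) qs) ys"
    unfolding list.rel_map by (rule list_all2_mono[OF comp.IH(1)]) simp
  then show ?case using comp.IH(2) by (auto intro: computes.comp)
next
  case (primrec_0 p xs y q)
  then show ?case by (auto intro: computes.primrec_0)
next
  case (primrec_Suc p q n xs y z)
  then show ?case by (auto intro: computes.primrec_Suc)
next
  case (mu p n xs)
  show ?case unfolding subst_query.simps
    by (rule computes.mu) (use mu.IH in blast)+
qed (auto intro: computes.intros r)

lemma oracle_free_subst_query: "oracle_free r \<Longrightarrow> oracle_free (subst_query r p)"
  by (induction p) auto

text \<open>Substituting \<open>Zero\<close> for \<open>Query\<close> answers every question as the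
  zero oracle does and leaves an oracle-free program.\<close>

lemma recursive_iff: "recursive g \<longleftrightarrow> (\<exists>p. \<forall>n. computes (\<lambda>_. 0) p [n] (g n))"
proof
  assume "\<exists>p. \<forall>n. computes (\<lambda>_. 0) p [n] (g n)"
  then obtain p where p: "\<forall>n. computes (\<lambda>_. 0) p [n] (g n)" by blast
  have "computes (\<lambda>_. 0) (subst_query Zero p) [n] (g n)" for n
    using p by (auto intro: computes_subst_query computes.zero)
  moreover have "oracle_free (subst_query Zero p)" by (rule oracle_free_subst_query) simp
  ultimately show "recursive g" unfolding recursive_def by blast
qed (auto simp: recursive_def)

lemma recursive_computes:
  assumes "recursive g" obtains p where "\<And>f n. computes f p [n] (g n)"
proof -
  obtain p where p: "oracle_free p" "\<And>n. computes (\<lambda>_. 0) p [n] (g n)"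
    using assms unfolding recursive_def by blast
  have "computes f (subst_query Zero p) [n] (g n)" for f n
    by (rule computes_subst_query[OF p(2)]) (rule computes.zero)
  then show ?thesis using that by blast
qed

lemma recursive_relative:
  assumes "recursive f" and "\<And>n. computes f p [n] (g n)"
  shows "recursive g"
proof -
  obtain r where "\<And>f' n. computes f' r [n] (f n)" using recursive_computes[OF assms(1)] by blast
  then have "\<forall>n. computes (\<lambda>_. 0) (subst_query r p) [n] (g n)"
    using assms(2) by (blast intro: computes_subst_query)
  then show ?thesis unfolding recursive_iff by blast
qed

lemma medvedev_reducible_refl: "\<A> \<le>\<^sub>s \<A>"
  unfolding medvedev_reducible_def by (blast intro: computes.query)

lemma medvedev_reducible_trans [trans]:
  assumes "\<A> \<le>\<^sub>s \<B>" "\<B> \<le>\<^sub>s \<C>" shows "\<A> \<le>\<^sub>s \<C>"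
proof -
  obtain p where p: "\<forall>f\<in>\<B>. \<exists>g\<in>\<A>. \<forall>n. computes f p [n] (g n)"
    using assms(1) unfolding medvedev_reducible_def by blast
  obtain q where q: "\<forall>f\<in>\<C>. \<exists>g\<in>\<B>. \<forall>n. computes f q [n] (g n)"
    using assms(2) unfolding medvedev_reducible_def by blast
  have "\<exists>g\<in>\<A>. \<forall>n. computes f (subst_query q p) [n] (g n)" if "f \<in> \<C>" for f
    by (meson computes_subst_query p q that)
  then show ?thesis unfolding medvedev_reducible_def by blast
qed

section \<open>Computable functionals\<close>

text \<open>
  The domain \<open>D\<close> may restrict both the oracle and the arguments: unbounded search is
  often total only for the oracles of a mass problem and only at reachable values.
\<close>

definition computable_on ::
    "((nat \<Rightarrow> nat) \<Rightarrow> nat list \<Rightarrow> bool) \<Rightarrow> nat \<Rightarrow> ((nat \<Rightarrow> nat) \<Rightarrow> nat list \<Rightarrow> nat) \<Rightarrow> bool" where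
  "computable_on D k F \<longleftrightarrow>
     (\<exists>p. \<forall>f xs. length xs = k \<longrightarrow> D f xs \<longrightarrow> computes f p xs (F f xs))"

lemma computable_on_cong:
  assumes "computable_on D k F" "\<And>f xs. length xs = k \<Longrightarrow> D f xs \<Longrightarrow> G f xs = F f xs"
  shows "computable_on D k G"
  using assms unfolding computable_on_def by metis

lemma computable_on_mono:
  assumes "computable_on D k F" "\<And>f xs. length xs = k \<Longrightarrow> D' f xs \<Longrightarrow> D f xs"
  shows "computable_on D' k F"
  using assms unfolding computable_on_def by blast

text \<open>\<open>E\<close> has to hold only at the tuples of values produced on \<open>D\<close>,
  so searches can be composed as long as they are called within their domain.\<close>

lemma computable_on_compose:
  assumes F: "computable_on E (length Gs) F"
    and Gs: "\<And>G. G \<in> set Gs \<Longrightarrow> computable_on D k G"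
    and E: "\<And>f xs. length xs = k \<Longrightarrow> D f xs \<Longrightarrow> E f (map (\<lambda>G. G f xs) Gs)"
  shows "computable_on D k (\<lambda>f xs. F f (map (\<lambda>G. G f xs) Gs))"
proof -
  obtain P where P: "\<And>G f xs. G \<in> set Gs \<Longrightarrow> length xs = k \<Longrightarrow> D f xs \<Longrightarrow> computes f (P G) xs (G f xs)"
    using Gs unfolding computable_on_def by metis
  obtain q where q: "\<And>f ys. length ys = length Gs \<Longrightarrow> E f ys \<Longrightarrow> computes f q ys (F f ys)"
    using F unfolding computable_on_def by blast
  have "computes f (Comp q (map P Gs)) xs (F f (map (\<lambda>G. G f xs) Gs))"
    if "length xs = k" "D f xs" for f xs
  proof (rule computes.comp)
    show "list_all2 (\<lambda>q y. computes f q xs y) (map P Gs) (map (\<lambda>G. G f xs) Gs)"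
      using P that by (auto simp: list.rel_map intro!: list.rel_refl_strong)
  qed (use q E that in simp)
  then show ?thesis unfolding computable_on_def by blast
qed

lemma computable_on_nth: "i < k \<Longrightarrow> computable_on D k (\<lambda>f xs. xs ! i)"
  unfolding computable_on_def by (auto intro!: exI[of _ "Proj i"] computes.proj)

lemma computable_on_nth_drop:
  assumes "n + i < k" shows "computable_on D k (\<lambda>f xs. drop n xs ! i)"
  by (rule computable_on_cong[OF computable_on_nth[OF assms]]) (use assms in simp)

lemma computable_on_compose1:
  assumes "computable_on (\<lambda>_ _. True) 1 (\<lambda>f xs. g f (xs ! 0))" "computable_on D k F"
  shows "computable_on D k (\<lambda>f xs. g f (F f xs))"
  using computable_on_compose[of "\<lambda>_ _. True" "[F]" "\<lambda>f xs. g f (xs ! 0)" D k] assms by simp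

lemma computable_on_Suc:
  assumes "computable_on D k F" shows "computable_on D k (\<lambda>f xs. Suc (F f xs))"
proof (rule computable_on_compose1[OF _ assms])
  show "computable_on (\<lambda>_ _. True) 1 (\<lambda>f xs. Suc (xs ! 0))"
    unfolding computable_on_def
    by (rule exI[of _ Succ]) (auto simp: length_Suc_conv intro: computes.succ)
qed

lemma computable_on_oracle:
  assumes "computable_on D k F" shows "computable_on D k (\<lambda>f xs. f (F f xs))"
proof (rule computable_on_compose1[OF _ assms])
  show "computable_on (\<lambda>_ _. True) 1 (\<lambda>f xs. f (xs ! 0))"
    unfolding computable_on_def
    by (rule exI[of _ Query]) (auto simp: length_Suc_conv intro: computes.query)
qed

lemma computable_on_const: "computable_on D k (\<lambda>f xs. c)"
proof (induction c)
  case 0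
  show ?case unfolding computable_on_def by (auto intro: computes.zero)
qed (rule computable_on_Suc)

lemma computable_on_recursive:
  assumes "recursive h" "computable_on D k F" shows "computable_on D k (\<lambda>f xs. h (F f xs))"
proof (rule computable_on_compose1[OF _ assms(2)])
  obtain p where "\<And>f n. computes f p [n] (h n)" using recursive_computes[OF assms(1)] by blast
  then show "computable_on (\<lambda>_ _. True) 1 (\<lambda>f xs. h (xs ! 0))"
    unfolding computable_on_def by (intro exI[of _ p]) (auto simp: length_Suc_conv)
qed

lemma recursive_if_computable_on:
  assumes "computable_on (\<lambda>f _. f = (\<lambda>_. 0)) 1 (\<lambda>f xs. g (xs ! 0))" shows "recursive g"
proof -
  obtain p where p: "\<And>xs. length xs = 1 \<Longrightarrow> computes (\<lambda>_. 0) p xs (g (xs ! 0))"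
    using assms unfolding computable_on_def by blast
  have "computes (\<lambda>_. 0) p [n] (g n)" for n using p[of "[n]"] by simp
  then show ?thesis unfolding recursive_iff by blast
qed

text \<open>The step function only has to be computed at the values that the recursion attains.\<close>

lemma computable_on_rec_nat:
  assumes B: "computable_on D k B"
    and S: "computable_on (\<lambda>f zs. D f (drop 2 zs) \<and>
              zs ! 1 = rec_nat (B f (drop 2 zs)) (\<lambda>n y. S f (drop 2 zs) n y) (zs ! 0))
            (Suc (Suc k)) (\<lambda>f zs. S f (drop 2 zs) (zs ! 0) (zs ! 1))"
    and N: "computable_on D k N"
  shows "computable_on D k (\<lambda>f xs. rec_nat (B f xs) (\<lambda>n y. S f xs n y) (N f xs))"
proof -
  obtain p where p: "\<And>f xs. length xs = k \<Longrightarrow> D f xs \<Longrightarrow> computes f p xs (B f xs)"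
    using B unfolding computable_on_def by blast
  obtain q where q: "\<And>f zs. length zs = Suc (Suc k) \<Longrightarrow> D f (drop 2 zs) \<Longrightarrow>
      zs ! 1 = rec_nat (B f (drop 2 zs)) (S f (drop 2 zs)) (zs ! 0) \<Longrightarrow>
      computes f q zs (S f (drop 2 zs) (zs ! 0) (zs ! 1))"
    using S unfolding computable_on_def by blast
  let ?R = "\<lambda>f xs. rec_nat (B f xs) (S f xs)"
  have run: "computes f (PrimRec p q) (n # xs) (?R f xs n)"
    if "length xs = k" "D f xs" for f xs n
  proof (induction n)
    case 0
    show ?case using p[OF that] by (simp add: computes.primrec_0)
  next
    case (Suc n)
    have "computes f q (n # ?R f xs n # xs) (S f xs n (?R f xs n))"
      using q[of "n # ?R f xs n # xs" f] that by simp
    with Suc show ?case by (simp add: computes.primrec_Suc)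
  qed
  let ?E = "\<lambda>f ys. D f (tl ys)"
  have "computable_on ?E (Suc k) (\<lambda>f ys. ?R f (tl ys) (ys ! 0))"
    unfolding computable_on_def
    by (rule exI[of _ "PrimRec p q"]) (auto simp: length_Suc_conv intro: run)
  moreover have ys: "map (\<lambda>G. G f xs) (N # map (\<lambda>i f xs. xs ! i) [0..<k]) = N f xs # xs"
    if "length xs = k" for f xs
    using map_nth[of xs] that by (simp add: comp_def)
  ultimately have "computable_on D k (\<lambda>f xs. (\<lambda>f ys. ?R f (tl ys) (ys ! 0)) f
        (map (\<lambda>G. G f xs) (N # map (\<lambda>i f xs. xs ! i) [0..<k])))"
    using N by (intro computable_on_compose[of ?E]) (auto intro: computable_on_nth)
  then show ?thesis
    by (rule computable_on_cong) (simp only: ys list.sel nth_Cons_0)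
qed

lemma computable_on_drop:
  assumes "computable_on D k F"
  shows "computable_on (\<lambda>f zs. D f (drop n zs)) (n + k) (\<lambda>f zs. F f (drop n zs))"
proof -
  have ys: "map (\<lambda>G. G f zs) (map (\<lambda>i f xs. xs ! (n + i)) [0..<k]) = drop n zs"
    if "length zs = n + k" for f :: "nat \<Rightarrow> nat" and zs :: "nat list"
    using that by (intro nth_equalityI) auto
  have "computable_on (\<lambda>f zs. D f (drop n zs)) (n + k)
      (\<lambda>f zs. F f (map (\<lambda>G. G f zs) (map (\<lambda>i f xs. xs ! (n + i)) [0..<k])))"
    using assms
    by (intro computable_on_compose[of D]) (auto simp: ys intro: computable_on_nth simp del: map_map)
  then show ?thesis by (rule computable_on_cong) (simp only: ys)
qed

section \<open>Arithmetic, decidable predicates and search\<close>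

lemma computable_on_add:
  assumes "computable_on D k F" "computable_on D k G"
  shows "computable_on D k (\<lambda>f xs. F f xs + G f xs)"
proof -
  have eq: "a + b = rec_nat a (\<lambda>_ y. Suc y) b" for a b :: nat by (induction b) auto
  show ?thesis unfolding eq
    by (intro computable_on_rec_nat assms computable_on_Suc computable_on_nth) simp
qed

lemma computable_on_diff:
  assumes "computable_on D k F" "computable_on D k G"
  shows "computable_on D k (\<lambda>f xs. F f xs - G f xs)"
proof -
  have pred: "computable_on D' k' (\<lambda>f xs. H f xs - 1)" if "computable_on D' k' H" for D' k' H
  proof -
    have eq: "a - 1 = rec_nat 0 (\<lambda>n y. n) a" for a :: nat by (cases a) auto
    show ?thesis unfolding eq
      by (intro computable_on_rec_nat that computable_on_const computable_on_nth) simp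
  qed
  have eq: "rec_nat a (\<lambda>_ y. y - 1) b = a - b" for a b :: nat by (induction b) auto
  have "computable_on D k (\<lambda>f xs. rec_nat (F f xs) (\<lambda>_ y. y - 1) (G f xs))"
    by (intro computable_on_rec_nat assms pred computable_on_nth) simp
  then show ?thesis unfolding eq .
qed

text \<open>Truth is coded by \<open>0\<close>, so that \<open>Mu\<close> can search for it
  directly.\<close>

definition decidable_on ::
    "((nat \<Rightarrow> nat) \<Rightarrow> nat list \<Rightarrow> bool) \<Rightarrow> nat \<Rightarrow> ((nat \<Rightarrow> nat) \<Rightarrow> nat list \<Rightarrow> bool) \<Rightarrow> bool" where
  "decidable_on D k P \<longleftrightarrow> computable_on D k (\<lambda>f xs. if P f xs then 0 else 1)"

text \<open>A case distinction is a recursion along the characteristic value: length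
  \<open>0\<close> returns \<open>F\<close>, and a single step returns \<open>G\<close>.\<close>

lemma computable_on_If:
  assumes P: "decidable_on D k P" and F: "computable_on D k F" and G: "computable_on D k G"
  shows "computable_on D k (\<lambda>f xs. if P f xs then F f xs else G f xs)"
proof -
  have "computable_on D k (\<lambda>f xs. rec_nat (F f xs) (\<lambda>_ _. G f xs) (if P f xs then 0 else 1))"
    using computable_on_drop[OF G, of 2]
    by (intro computable_on_rec_nat F P[unfolded decidable_on_def])
      (auto intro: computable_on_mono)
  then show ?thesis by (rule computable_on_cong) simp
qed

lemma decidable_on_zero:
  assumes "computable_on D k F" shows "decidable_on D k (\<lambda>f xs. F f xs = 0)"
proof -
  have eq: "(if a = 0 then 0 else 1) = 1 - (1 - a)" for a :: nat by simp
  show ?thesis unfolding decidable_on_def eq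
    by (intro computable_on_diff computable_on_const assms)
qed

lemma decidable_on_le:
  assumes "computable_on D k F" "computable_on D k G"
  shows "decidable_on D k (\<lambda>f xs. F f xs \<le> G f xs)"
  using decidable_on_zero[OF computable_on_diff[OF assms]] by simp

lemma decidable_on_less:
  assumes "computable_on D k F" "computable_on D k G"
  shows "decidable_on D k (\<lambda>f xs. F f xs < G f xs)"
  using decidable_on_le[OF computable_on_Suc[OF assms(1)] assms(2)] by (simp add: Suc_le_eq)

lemma decidable_on_conj:
  assumes "decidable_on D k P" "decidable_on D k Q"
  shows "decidable_on D k (\<lambda>f xs. P f xs \<and> Q f xs)"
proof -
  have eq: "(if a \<and> b then 0 else 1 :: nat) = (if a then if b then 0 else 1 else 1)" for a b by simp
  show ?thesis unfolding decidable_on_def eq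
    by (intro computable_on_If assms computable_on_const)
qed

lemma decidable_on_not:
  assumes "decidable_on D k P" shows "decidable_on D k (\<lambda>f xs. \<not> P f xs)"
proof -
  have eq: "(if \<not> a then 0 else 1 :: nat) = (if a then 1 else 0)" for a by simp
  show ?thesis unfolding decidable_on_def eq by (intro computable_on_If assms computable_on_const)
qed

lemma decidable_on_imp:
  assumes "decidable_on D k P" "decidable_on D k Q"
  shows "decidable_on D k (\<lambda>f xs. P f xs \<longrightarrow> Q f xs)"
  using decidable_on_not[OF decidable_on_conj[OF assms(1) decidable_on_not[OF assms(2)]]] by simp

lemma decidable_on_eq:
  assumes "computable_on D k F" "computable_on D k G"
  shows "decidable_on D k (\<lambda>f xs. F f xs = G f xs)"
  unfolding order_eq_iff by (intro decidable_on_conj decidable_on_le assms)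

lemma decidable_on_finite:
  assumes "finite A" "computable_on D k F" shows "decidable_on D k (\<lambda>f xs. F f xs \<in> A)"
  using assms(1)
proof induction
  case empty
  show ?case unfolding decidable_on_def by (simp add: computable_on_const)
next
  case (insert a A)
  show ?case
    using decidable_on_imp[OF decidable_on_not[OF
        decidable_on_eq[OF assms(2) computable_on_const[of _ _ a]]] insert.IH]
    by (simp add: disj_imp)
qed

text \<open>The recursion keeps the value \<open>0\<close> until a counterexample turns it into
  \<open>1\<close>. The first two entries of \<open>zs\<close> are the counter and the running
  value.\<close>

lemma decidable_on_all_less:
  assumes P: "decidable_on (\<lambda>f zs. D f (drop 2 zs)) (Suc (Suc k)) (\<lambda>f zs. P f (drop 2 zs) (zs ! 0))"
    and N: "computable_on D k N"
  shows "decidable_on D k (\<lambda>f xs. \<forall>i<N f xs. P f xs i)"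
proof -
  have eq: "(if \<forall>i<n. Q i then 0 else 1) = rec_nat (0::nat) (\<lambda>i y. if Q i then y else 1) n" for Q n
    by (induction n) (auto simp: less_Suc_eq)
  have P': "decidable_on (\<lambda>f zs. D f (drop 2 zs) \<and> E f zs) (Suc (Suc k)) (\<lambda>f zs. P f (drop 2 zs) (zs ! 0))"
    for E using P unfolding decidable_on_def by (rule computable_on_mono) simp
  show ?thesis unfolding decidable_on_def eq
    by (intro computable_on_rec_nat N computable_on_If P' computable_on_const computable_on_nth) simp
qed

lemma decidable_on_ex_less:
  assumes "decidable_on (\<lambda>f zs. D f (drop 2 zs)) (Suc (Suc k)) (\<lambda>f zs. P f (drop 2 zs) (zs ! 0))"
    and "computable_on D k N"
  shows "decidable_on D k (\<lambda>f xs. \<exists>i<N f xs. P f xs i)"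
  using decidable_on_not[OF decidable_on_all_less[OF decidable_on_not[OF assms(1)] assms(2)]] by simp

lemma computable_on_Least:
  assumes P: "decidable_on (\<lambda>f zs. D f (drop 1 zs)) (Suc k) (\<lambda>f zs. P f (drop 1 zs) (zs ! 0))"
    and ex: "\<And>f xs. length xs = k \<Longrightarrow> D f xs \<Longrightarrow> \<exists>n. P f xs n"
  shows "computable_on D k (\<lambda>f xs. LEAST n. P f xs n)"
proof -
  obtain p where p: "\<And>f zs. length zs = Suc k \<Longrightarrow> D f (drop 1 zs) \<Longrightarrow>
      computes f p zs (if P f (drop 1 zs) (zs ! 0) then 0 else 1)"
    using P unfolding decidable_on_def computable_on_def by blast
  have "computes f (Mu p) xs (LEAST n. P f xs n)" if "length xs = k" "D f xs" for f xs
  proof (rule computes.mu)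
    have p': "computes f p (n # xs) (if P f xs n then 0 else 1)" for n
      using p[of "n # xs" f] that by simp
    show "computes f p ((LEAST n. P f xs n) # xs) 0"
      using p'[of "LEAST n. P f xs n"] LeastI_ex[OF ex[OF that]] by simp
    show "\<forall>m<LEAST n. P f xs n. \<exists>y>0. computes f p (m # xs) y"
      using p' not_less_Least by (metis zero_less_one)
  qed
  then show ?thesis unfolding computable_on_def by blast
qed

lemmas computable_intros =
  computable_on_nth computable_on_nth_drop computable_on_Suc computable_on_const computable_on_add
  computable_on_diff computable_on_If decidable_on_le decidable_on_less decidable_on_conj
  decidable_on_not decidable_on_imp decidable_on_eq decidable_on_all_less decidable_on_ex_less

section \<open>Pairing, binary codes of finite sets and coded sequences\<close>

lemma computable_on_triangle:
  assumes "computable_on D k F" shows "computable_on D k (\<lambda>f xs. triangle (F f xs))"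
proof -
  have eq: "triangle n = rec_nat 0 (\<lambda>n y. y + Suc n) n" for n by (induction n) auto
  show ?thesis unfolding eq by (intro computable_on_rec_nat assms computable_intros) auto
qed

lemma computable_on_prod_encode:
  assumes "computable_on D k F" "computable_on D k G"
  shows "computable_on D k (\<lambda>f xs. prod_encode (F f xs, G f xs))"
  unfolding prod_encode_def prod.case by (intro computable_on_triangle computable_intros assms)

lemma triangle_mono: "m \<le> n \<Longrightarrow> triangle m \<le> triangle n"
  by (induction n) (auto simp: le_Suc_eq)

lemma prod_decode_conv:
  "triangle (fst (prod_decode z) + snd (prod_decode z)) + fst (prod_decode z) = z"
  using prod_decode_inverse[of z] by (simp add: prod_encode_def split_beta)

text \<open>The code \<open>z\<close> lies on the diagonal numbered by the sum of its components,
  and \<open>triangle w\<close> is the first code on diagonal \<open>w\<close>. Decoding thus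
  becomes a search.\<close>

lemma prod_decode_sum: "fst (prod_decode z) + snd (prod_decode z) = (LEAST w. z < triangle (Suc w))"
proof (rule Least_equality[symmetric])
  show "z < triangle (Suc (fst (prod_decode z) + snd (prod_decode z)))"
    using prod_decode_conv[of z] by simp
  fix w assume "z < triangle (Suc w)"
  then have "\<not> triangle (Suc w) \<le> triangle (fst (prod_decode z) + snd (prod_decode z))"
    using prod_decode_conv[of z] by linarith
  then show "fst (prod_decode z) + snd (prod_decode z) \<le> w"
    using triangle_mono[of "Suc w"] not_less_eq_eq by blast
qed

lemma prod_decode_fst:
  "fst (prod_decode z) = z - triangle (LEAST w. z < triangle (Suc w))"
  unfolding prod_decode_sum[symmetric] using prod_decode_conv[of z] by linarith

lemma computable_on_Least_triangle:
  assumes "computable_on D k F"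
  shows "computable_on D k (\<lambda>f xs. LEAST w. F f xs < triangle (Suc w))"
proof (rule computable_on_compose1[OF _ assms])
  have "n < triangle (Suc n)" for n by (induction n) auto
  then have "\<exists>w. n < triangle (Suc w)" for n by blast
  then show "computable_on (\<lambda>_ _. True) 1 (\<lambda>f xs. LEAST w. xs ! 0 < triangle (Suc w))"
    by (intro computable_on_Least computable_intros computable_on_triangle) (auto simp del: triangle_Suc)
qed

lemma computable_on_fst:
  assumes "computable_on D k F" shows "computable_on D k (\<lambda>f xs. fst (prod_decode (F f xs)))"
  unfolding prod_decode_fst
  by (intro computable_on_triangle computable_intros computable_on_Least_triangle assms)

lemma computable_on_snd:
  assumes "computable_on D k F" shows "computable_on D k (\<lambda>f xs. snd (prod_decode (F f xs)))"
proof -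
  have eq: "snd (prod_decode z) = (LEAST w. z < triangle (Suc w)) - fst (prod_decode z)" for z
    unfolding prod_decode_sum[symmetric] by simp
  show ?thesis unfolding eq
    by (intro computable_on_fst computable_intros computable_on_Least_triangle assms)
qed

lemma computable_on_power_two:
  assumes "computable_on D k F" shows "computable_on D k (\<lambda>f xs. 2 ^ F f xs)"
proof -
  have eq: "2 ^ n = rec_nat (1::nat) (\<lambda>_ y. y + y) n" for n by (induction n) auto
  show ?thesis unfolding eq by (intro computable_on_rec_nat assms computable_intros) auto
qed

lemma computable_on_half:
  assumes "computable_on D k F" shows "computable_on D k (\<lambda>f xs. F f xs div 2)"
proof (rule computable_on_compose1[OF _ assms])
  have "(LEAST q. n < Suc (Suc (q + q))) = n div 2" for n :: nat by (rule Least_equality) auto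
  moreover have "\<exists>q. n < Suc (Suc (q + q))" for n by (rule exI[of _ n]) simp
  then have "computable_on (\<lambda>_ _. True) 1 (\<lambda>f xs. LEAST q. xs ! 0 < Suc (Suc (q + q)))"
    by (intro computable_on_Least computable_intros) auto
  ultimately show "computable_on (\<lambda>_ _. True) 1 (\<lambda>f xs. xs ! 0 div 2)" by simp
qed

lemma decidable_on_set_decode:
  assumes "computable_on D k F" "computable_on D k G"
  shows "decidable_on D k (\<lambda>f xs. F f xs \<in> set_decode (G f xs))"
proof -
  have half: "n div 2 ^ e = rec_nat n (\<lambda>_ y. y div 2) e" for n e :: nat
    by (induction e) (auto simp: div_mult2_eq power_Suc2 simp del: power_Suc)
  have odd: "odd n \<longleftrightarrow> \<not> n = n div 2 + n div 2" for n :: nat by presburger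
  show ?thesis unfolding set_decode_def mem_Collect_eq odd half
    by (intro computable_intros computable_on_half computable_on_rec_nat assms) auto
qed

text \<open>Every number codes an infinite sequence by iterated pairing. Such codes serve as tables
  of values and as oracle approximations.\<close>

definition lookup :: "nat \<Rightarrow> nat \<Rightarrow> nat" where
  "lookup t i = fst (prod_decode (rec_nat t (\<lambda>_ y. snd (prod_decode y)) i))"

lemma computable_on_lookup:
  assumes "computable_on D k F" "computable_on D k G"
  shows "computable_on D k (\<lambda>f xs. lookup (F f xs) (G f xs))"
  unfolding lookup_def
  by (intro computable_on_fst computable_on_snd computable_on_rec_nat computable_intros assms) auto

lemma rec_nat_shift: "rec_nat (h t) (\<lambda>_. h) i = h (rec_nat t (\<lambda>_. h) i)"
  by (induction i) auto

lemma lookup_prod_encode [simp]: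
  "lookup (prod_encode (a, t)) 0 = a"
  "lookup (prod_encode (a, t)) (Suc i) = lookup t i"
  using rec_nat_shift[of "\<lambda>y. snd (prod_decode y)" "prod_encode (a, t)" i]
  by (simp_all add: lookup_def)

lemma lookup_surj: "\<exists>t. \<forall>i<n. lookup t i = g i"
proof (induction n arbitrary: g)
  case (Suc n)
  then obtain t where "\<forall>i<n. lookup t i = g (Suc i)" by meson
  then have "\<forall>i<Suc n. lookup (prod_encode (g 0, t)) i = g i"
    by (auto simp: less_Suc_eq_0_disj)
  then show ?case by blast
qed simp

section \<open>Bounded evaluation\<close>

text \<open>
  Evaluation with the search in \<open>Mu\<close> cut off at \<open>s\<close>; the result \<open>0\<close> means
  ``no value found'', and \<open>Suc y\<close> means the value \<open>y\<close>. Since all other schemata are total,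
  this is a computable function of \<open>s\<close> and of the arguments for each fixed program, which
  makes a universal program unnecessary. In the search, \<open>1\<close> stands for ``still searching''
  and \<open>Suc (Suc n)\<close> for ``found \<open>n\<close>''.
\<close>

fun search_upto :: "(nat \<Rightarrow> nat) \<Rightarrow> nat \<Rightarrow> nat" where
  "search_upto v 0 = 1"
| "search_upto v (Suc n) = (if search_upto v n = 1 then if v n = 0 then 0
     else if v n = 1 then Suc (Suc n) else 1 else search_upto v n)"

fun eval_upto :: "nat \<Rightarrow> (nat \<Rightarrow> nat) \<Rightarrow> prog \<Rightarrow> nat list \<Rightarrow> nat" where
  "eval_upto s g Zero xs = 1"
| "eval_upto s g Succ xs = (if length xs = 1 then Suc (Suc (xs ! 0)) else 0)"
| "eval_upto s g (Proj i) xs = (if i < length xs then Suc (xs ! i) else 0)"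
| "eval_upto s g Query xs = (if length xs = 1 then Suc (g (xs ! 0)) else 0)"
| "eval_upto s g (Comp p qs) xs =
     (if \<forall>q\<in>set qs. eval_upto s g q xs \<noteq> 0
      then eval_upto s g p (map (\<lambda>q. eval_upto s g q xs - 1) qs) else 0)"
| "eval_upto s g (PrimRec p q) xs = (case xs of [] \<Rightarrow> 0 | n # zs \<Rightarrow>
     rec_nat (eval_upto s g p zs)
       (\<lambda>m y. if y = 0 then 0 else eval_upto s g q (m # (y - 1) # zs)) n)"
| "eval_upto s g (Mu p) xs =
     search_upto (\<lambda>n. eval_upto s g p (n # xs)) s - 1"

lemma search_upto_conv:
  "search_upto v s = rec_nat 1 (\<lambda>n y. if y = 1 then if v n = 0 then 0
     else if v n = 1 then Suc (Suc n) else 1 else y) s"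
  by (induction s) auto

lemma search_upto_oneD: "search_upto v s = 1 \<Longrightarrow> m < s \<Longrightarrow> 1 < v m"
proof (induction s)
  case (Suc s)
  have s: "search_upto v s = 1" using Suc.prems(1) by (simp split: if_split_asm)
  have "v s \<noteq> 0" using Suc.prems(1) by (simp split: if_split_asm)
  moreover have "search_upto v (Suc s) = Suc (Suc s)" if "v s = 1" using s that by simp
  then have "v s \<noteq> 1" using Suc.prems(1) by linarith
  ultimately have vs: "1 < v s" by linarith
  show ?case
  proof (cases "m = s")
    case True
    then show ?thesis using vs by simp
  next
    case False
    then show ?thesis using Suc.IH[OF s] Suc.prems(2) by simp
  qed
qed simp

lemma search_upto_SucD:
  "search_upto v s = Suc (Suc n) \<Longrightarrow> v n = 1 \<and> (\<forall>m<n. 1 < v m)"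
proof (induction s)
  case (Suc s)
  show ?case
  proof (cases "search_upto v s = 1")
    case True
    have "v s = 1"
    proof (rule ccontr)
      assume "v s \<noteq> 1"
      then have "search_upto v (Suc s) \<le> 1" using True by simp
      then show False using Suc.prems by linarith
    qed
    moreover from this have "n = s" using True Suc.prems by simp
    ultimately show ?thesis using search_upto_oneD[OF True] by blast
  next
    case False
    then have "search_upto v s = Suc (Suc n)" using Suc.prems by simp
    then show ?thesis by (rule Suc.IH)
  qed
qed simp

lemma search_upto_found:
  assumes "v n = 1" "\<forall>m<n. 1 < v m" "n < s"
  shows "search_upto v s = Suc (Suc n)"
proof -
  have "m \<le> n \<Longrightarrow> search_upto v m = 1" for m
  proof (induction m)
    case (Suc m)
    then have "1 < v m" using assms(2) by simp
    then show ?case using Suc by simp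
  qed simp
  then have start: "search_upto v n = 1" by simp
  \<comment> \<open>A found value differs from \<open>1\<close>, so further steps only copy
    it.\<close>
  have "search_upto v (Suc n + d) = Suc (Suc n)" for d using assms(1) start by (induction d) auto
  from this[of "s - Suc n"] assms(3) show ?thesis by simp
qed

lemma eval_upto_sound: "eval_upto s g p xs = Suc y \<Longrightarrow> computes g p xs y"
proof (induction p arbitrary: xs y)
  case Zero
  then show ?case by (auto intro: computes.zero)
next
  case Succ
  then show ?case by (auto simp: length_Suc_conv split: if_splits intro: computes.succ)
next
  case (Proj i)
  then show ?case by (auto split: if_splits intro: computes.proj)
next
  case Query
  then show ?case by (auto simp: length_Suc_conv split: if_splits intro: computes.query)
next
  case (Comp p qs)
  let ?ys = "map (\<lambda>q. eval_upto s g q xs - 1) qs"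
  have nz: "\<forall>q\<in>set qs. eval_upto s g q xs \<noteq> 0" and p: "eval_upto s g p ?ys = Suc y"
    using Comp.prems by (auto split: if_splits)
  show ?case
  proof (rule computes.comp)
    show "list_all2 (\<lambda>q y. computes g q xs y) qs ?ys"
      using Comp.IH(2) nz by (auto simp: list.rel_map intro!: list.rel_refl_strong)
  qed (rule Comp.IH(1)[OF p])
next
  case (PrimRec p q)
  then obtain n zs where xs: "xs = n # zs" by (cases xs) auto
  let ?R = "rec_nat (eval_upto s g p zs) (\<lambda>n y. if y = 0 then 0 else eval_upto s g q (n # (y - 1) # zs))"
  have "?R n = Suc y \<Longrightarrow> computes g (PrimRec p q) (n # zs) y" for n y
  proof (induction n arbitrary: y)
    case 0
    then show ?case using PrimRec.IH(1) by (auto intro: computes.primrec_0)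
  next
    case (Suc n)
    then obtain z where z: "?R n = Suc z" by (cases "?R n") auto
    then have "computes g q (n # z # zs) y" using Suc.prems PrimRec.IH(2) by simp
    then show ?case using Suc.IH[OF z] by (auto intro: computes.primrec_Suc)
  qed
  then show ?case using PrimRec.prems xs by simp
next
  case (Mu p)
  let ?v = "\<lambda>n. eval_upto s g p (n # xs)"
  have "search_upto ?v s = Suc (Suc y)" using Mu.prems by simp
  from search_upto_SucD[OF this] have v: "?v y = 1" "\<forall>m<y. 1 < ?v m" by auto
  show ?case
  proof (rule computes.mu)
    show "computes g p (y # xs) 0" using Mu.IH v(1) by simp
    show "\<forall>m<y. \<exists>z>0. computes g p (m # xs) z"
    proof (intro allI impI)
      fix m assume "m < y"
      then have "1 < ?v m" using v(2) by blast
      then have "?v m = Suc (?v m - 1)" "0 < ?v m - 1" by auto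
      then show "\<exists>z>0. computes g p (m # xs) z" using Mu.IH by blast
    qed
  qed
qed

text \<open>A derivation contains finitely many searches, so all large cutoffs suffice. Eventual
  truth combines the bounds of the subcomputations.\<close>

lemma eval_upto_complete:
  assumes "computes g p xs y"
  shows "\<forall>\<^sub>F s in sequentially. eval_upto s g p xs = Suc y"
  using assms
proof (induction rule: computes.induct)
  case (comp xs qs ys p z)
  have "\<forall>\<^sub>F s in sequentially. list_all2 (\<lambda>q y. eval_upto s g q xs = Suc y) qs ys"
    using comp.IH(1)
  proof (induction rule: list_all2_induct)
    case (Cons q qs y ys)
    then show ?case by (auto intro: eventually_conj)
  qed simp
  with comp.IH(2) show ?case
  proof eventually_elim
    case (elim s)
    have "map (\<lambda>q. eval_upto s g q xs - 1) qs = ys"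
      using elim(2) by (induction rule: list_all2_induct) auto
    moreover have "\<forall>q\<in>set qs. eval_upto s g q xs \<noteq> 0"
      using elim(2) by (induction rule: list_all2_induct) auto
    ultimately show ?case using elim(1) by simp
  qed
next
  case (primrec_0 p xs y q)
  then show ?case by simp
next
  case (primrec_Suc p q n xs y z)
  from primrec_Suc.IH show ?case by eventually_elim simp
next
  case (mu p n xs)
  have "\<forall>m\<in>{..<n}. \<forall>\<^sub>F s in sequentially. 1 < eval_upto s g p (m # xs)"
  proof
    fix m assume "m \<in> {..<n}"
    then obtain y where "y > 0" "\<forall>\<^sub>F s in sequentially. eval_upto s g p (m # xs) = Suc y"
      using mu.IH(2) by blast
    then show "\<forall>\<^sub>F s in sequentially. 1 < eval_upto s g p (m # xs)"
      by (auto elim: eventually_mono)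
  qed
  then have "\<forall>\<^sub>F s in sequentially. \<forall>m\<in>{..<n}. 1 < eval_upto s g p (m # xs)"
    by (intro eventually_ball_finite) auto
  with mu.IH(1) eventually_gt_at_top[of n] show ?case
  proof eventually_elim
    case (elim s)
    then show ?case using search_upto_found[of "\<lambda>n. eval_upto s g p (n # xs)" n s] by simp
  qed
qed auto

lemma decidable_on_Ball_list:
  assumes "\<And>q. q \<in> set qs \<Longrightarrow> decidable_on D k (P q)"
  shows "decidable_on D k (\<lambda>f xs. \<forall>q\<in>set qs. P q f xs)"
  using assms
proof (induction qs)
  case Nil
  show ?case by (simp add: decidable_on_def computable_on_const)
next
  case (Cons q qs)
  then show ?case using decidable_on_conj[of D k "P q"] by simp
qed

text \<open>Induction on the fixed program. The arguments are a list of functionals because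
  \<open>Comp\<close> and \<open>PrimRec\<close> change them; the oracle is taken from a family
  \<open>orc\<close> with a computed index, so that a search can also run through oracles.\<close>

lemma computable_on_eval_upto:
  assumes orc: "\<And>D k F G. computable_on D k F \<Longrightarrow> computable_on D k G \<Longrightarrow>
      computable_on D k (\<lambda>f xs. orc (F f xs) (G f xs))"
  assumes "computable_on D k S" "computable_on D k C" "\<And>G. G \<in> set Gs \<Longrightarrow> computable_on D k G"
  shows "computable_on D k (\<lambda>f xs. eval_upto (S f xs) (orc (C f xs)) p (map (\<lambda>G. G f xs) Gs))"
  using assms(2-)
proof (induction p arbitrary: D k S C Gs)
  case Zero
  show ?case by (simp add: computable_on_const)
next
  case Succ
  then show ?case by (cases "length Gs = 1") (auto simp: length_Suc_conv intro!: computable_intros)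
next
  case (Proj i)
  then show ?case by (cases "i < length Gs") (auto intro!: computable_intros)
next
  case Query
  then show ?case by (cases "length Gs = 1") (auto simp: length_Suc_conv intro!: computable_intros orc)
next
  case (Comp p qs)
  let ?e = "\<lambda>q f xs. eval_upto (S f xs) (orc (C f xs)) q (map (\<lambda>G. G f xs) Gs)"
  have q: "computable_on D k (?e q)" if "q \<in> set qs" for q
    using Comp.IH(2) Comp.prems that by blast
  have "computable_on D k (\<lambda>f xs. eval_upto (S f xs) (orc (C f xs)) p
      (map (\<lambda>G. G f xs) (map (\<lambda>q f xs. ?e q f xs - 1) qs)))"
    by (rule Comp.IH(1)) (use Comp.prems q in \<open>auto intro!: computable_intros\<close>)
  then show ?case unfolding eval_upto.simps
    by (intro computable_on_If decidable_on_Ball_list decidable_on_not decidable_on_zero q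
        computable_on_const) (simp_all add: comp_def)
next
  case (PrimRec p q)
  show ?case
  proof (cases Gs)
    case Nil
    then show ?thesis by (simp add: computable_on_const)
  next
    case (Cons N Hs)
    have N: "computable_on D k N" and H: "\<And>G. G \<in> set Hs \<Longrightarrow> computable_on D k G"
      using PrimRec.prems Cons by auto
    have lift: "computable_on (\<lambda>f zs. D f (drop 2 zs) \<and> E f zs) (Suc (Suc k)) (\<lambda>f zs. G f (drop 2 zs))"
      if "computable_on D k G" for G E
      using computable_on_drop[OF that, of 2] by (auto intro: computable_on_mono)
    have q: "computable_on (\<lambda>f zs. D f (drop 2 zs) \<and> E f zs) (Suc (Suc k))
       (\<lambda>f zs. eval_upto (S f (drop 2 zs)) (orc (C f (drop 2 zs))) q
         (map (\<lambda>G. G f zs) ((\<lambda>f zs. zs ! 0) # (\<lambda>f zs. zs ! 1 - 1) # map (\<lambda>G f zs. G f (drop 2 zs)) Hs)))"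
      for E
      by (rule PrimRec.IH(2)) (use PrimRec.prems H in \<open>auto intro!: lift computable_intros\<close>)
    have p: "computable_on D k (\<lambda>f xs. eval_upto (S f xs) (orc (C f xs)) p (map (\<lambda>G. G f xs) Hs))"
      using PrimRec.IH(1) PrimRec.prems H by blast
    show ?thesis unfolding Cons eval_upto.simps list.map list.case
      by (intro computable_on_rec_nat computable_on_If decidable_on_zero computable_on_const
          computable_on_nth p q[unfolded list.map map_map comp_def] N) simp_all
  qed
next
  case (Mu p)
  have lift: "computable_on (\<lambda>f zs. D f (drop 2 zs) \<and> E f zs) (Suc (Suc k)) (\<lambda>f zs. G f (drop 2 zs))"
    if "computable_on D k G" for G E
    using computable_on_drop[OF that, of 2] by (auto intro: computable_on_mono)
  have p: "computable_on (\<lambda>f zs. D f (drop 2 zs) \<and> E f zs) (Suc (Suc k))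
     (\<lambda>f zs. eval_upto (S f (drop 2 zs)) (orc (C f (drop 2 zs))) p
       (map (\<lambda>G. G f zs) ((\<lambda>f zs. zs ! 0) # map (\<lambda>G f zs. G f (drop 2 zs)) Gs)))"
    for E
    by (rule Mu.IH) (use Mu.prems in \<open>auto intro!: lift computable_intros\<close>)
  show ?case unfolding eval_upto.simps search_upto_conv
    by (intro computable_on_diff computable_on_rec_nat computable_on_If decidable_on_zero
        decidable_on_eq computable_on_const computable_on_Suc computable_on_nth
        p[unfolded list.map map_map comp_def] Mu.prems(1)) simp_all
qed

section \<open>Generic self-enumerating trees\<close>

text \<open>The child of \<open>w\<close> with label \<open>a\<close>. The number \<open>0\<close>
  is left for the root, and every positive number is a node.\<close>

definition node :: "nat \<Rightarrow> nat \<Rightarrow> nat" where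
  "node a w = Suc (prod_encode (a, w))"

lemma node_eq [simp]: "node a w = node b v \<longleftrightarrow> a = b \<and> w = v"
  and node_nonzero [simp]: "node a w \<noteq> 0"
  by (simp_all add: node_def)

lemma node_greater: "a < node a w" "w < node a w"
  by (simp_all add: node_def less_Suc_eq_le le_prod_encode_1 le_prod_encode_2)

lemma node_decode: "Suc z = node (fst (prod_decode z)) (snd (prod_decode z))"
  by (simp add: node_def)

text \<open>\<open>label a w\<close> says that \<open>a\<close> occurs on the way from the root to
  \<open>w\<close>, so that a path through \<open>w\<close> has \<open>a\<close> among its
  values.\<close>

inductive label :: "nat \<Rightarrow> nat \<Rightarrow> bool" where
  last: "label a (node a w)"
| earlier: "label a w \<Longrightarrow> label a (node b w)"

lemma label_less: "label a w \<Longrightarrow> a < w"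
  by (induction rule: label.induct) (use node_greater less_trans in blast)+

definition inner :: "nat set \<Rightarrow> nat set" where
  "inner F = {w. \<exists>a. node a w \<in> F}"

definition condition :: "nat set \<Rightarrow> bool" where
  "condition F \<longleftrightarrow> finite F \<and> 0 \<in> F \<and> (\<forall>a w. node a w \<in> F \<longrightarrow> a \<in> F \<and> w \<in> F)"

lemma conditionD:
  assumes "condition F"
  shows "finite F" "0 \<in> F" "node a w \<in> F \<Longrightarrow> a \<in> F" "node a w \<in> F \<Longrightarrow> w \<in> F"
  using assms unfolding condition_def by blast+

lemma conditionI:
  assumes "finite F" "0 \<in> F" "\<And>a w. node a w \<in> F \<Longrightarrow> a \<in> F \<and> w \<in> F" shows "condition F"
proof -
  have "\<forall>a w. node a w \<in> F \<longrightarrow> a \<in> F \<and> w \<in> F" by (intro allI impI) (rule assms(3))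
  then show ?thesis unfolding condition_def by (rule conjI[OF assms(1) conjI[OF assms(2)]])
qed

lemma inner_mono: "F \<subseteq> G \<Longrightarrow> inner F \<subseteq> inner G"
  unfolding inner_def by blast

lemma condition_Un:
  assumes "condition F" "condition G" shows "condition (F \<union> G)"
proof (rule conditionI)
  show "a \<in> F \<union> G \<and> w \<in> F \<union> G" if "node a w \<in> F \<union> G" for a w
    using that conditionD(3,4)[OF assms(1), of a w] conditionD(3,4)[OF assms(2), of a w] by blast
qed (use conditionD(1,2)[OF assms(1)] conditionD(1)[OF assms(2)] in simp_all)

lemma condition_insert:
  assumes "condition F" "a \<in> F" "w \<in> F" shows "condition (insert (node a w) F)"
proof (rule conditionI)
  show "b \<in> insert (node a w) F \<and> v \<in> insert (node a w) F" if "node b v \<in> insert (node a w) F" for b v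
    using that assms(2,3) conditionD(3,4)[OF assms(1), of b v] unfolding insert_iff node_eq by blast
qed (use conditionD(1,2)[OF assms(1)] in simp_all)

text \<open>The nodes that may still enter the tree once the children of all nodes in \<open>inner F\<close> are fixed.\<close>

inductive_set future :: "nat set \<Rightarrow> nat set" for F where
  base: "w \<in> F \<Longrightarrow> w \<in> future F"
| child: "w \<in> future F \<Longrightarrow> w \<notin> inner F \<Longrightarrow> a \<in> future F \<Longrightarrow> node a w \<in> future F"

lemma future_nodeE:
  assumes "node a w \<in> future F"
  obtains "node a w \<in> F" | "w \<in> future F" "w \<notin> inner F" "a \<in> future F"
  using assms by (cases rule: future.cases) auto

lemma future_frozen: "node a w \<in> future F \<Longrightarrow> w \<in> inner F \<Longrightarrow> node a w \<in> F"
  by (elim future_nodeE) auto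

text \<open>Enlarging \<open>F\<close> within its future only freezes more nodes, and the new nodes
  were already derivable from \<open>F\<close>.\<close>

lemma future_mono:
  assumes "F \<subseteq> G" "G \<subseteq> future F" shows "future G \<subseteq> future F"
proof
  fix w assume "w \<in> future G"
  then show "w \<in> future F"
    by induction (use assms inner_mono[OF assms(1)] in \<open>auto intro: future.child\<close>)
qed

section \<open>Extensions of conditions\<close>

definition extends :: "nat set \<Rightarrow> nat set \<Rightarrow> bool" where
  "extends F G \<longleftrightarrow> condition G \<and> F \<subseteq> G \<and> G \<subseteq> future F"

lemma extends_trans: "extends F G \<Longrightarrow> extends G H \<Longrightarrow> extends F H"
  unfolding extends_def using future_mono by blast

lemma extends_refl: "condition F \<Longrightarrow> extends F F"
  unfolding extends_def by (auto intro: future.base)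

text \<open>Follow the derivation of \<open>d\<close> and join the extensions found for its parent
  and its label. The join is admissible because only the inner nodes of \<open>F\<close> are frozen,
  not those of the two extensions.\<close>

lemma extends_member:
  assumes F: "condition F" and "d \<in> future F" obtains G where "extends F G" "d \<in> G"
proof -
  have "\<exists>G. extends F G \<and> d \<in> G" using assms(2)
  proof induction
    case (base w)
    then show ?case using extends_refl[OF F] by blast
  next
    case (child w a)
    then obtain G H where GH: "extends F G" "w \<in> G" "extends F H" "a \<in> H" by blast
    let ?K = "insert (node a w) (G \<union> H)"
    have "condition (G \<union> H)" using GH condition_Un unfolding extends_def by blast
    then have "condition ?K" using GH by (intro condition_insert) auto
    moreover have "node a w \<in> future F" using child.hyps by (intro future.child)
    ultimately have "extends F ?K" using GH unfolding extends_def by auto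
    then show ?case by blast
  qed
  then show ?thesis using that by blast
qed

lemma extends_finite:
  assumes F: "condition F" and "finite D" "D \<subseteq> future F" obtains G where "extends F G" "D \<subseteq> G"
proof -
  have "\<exists>G. extends F G \<and> D \<subseteq> G" using assms(2,3)
  proof (induction D)
    case empty
    then show ?case using extends_refl[OF F] by blast
  next
    case (insert d D)
    then obtain G where G: "extends F G" "D \<subseteq> G" by blast
    obtain H where H: "extends F H" "d \<in> H" using extends_member[OF F] insert.prems by blast
    have "extends F (G \<union> H)"
      using G(1) H(1) condition_Un unfolding extends_def by blast
    then show ?case using G H by (intro exI[of _ "G \<union> H"]) auto
  qed
  then show ?thesis using that by blast
qed

text \<open>To treat one label \<open>b\<close>, give every leaf a child labelled \<open>b\<close>.
  The new leaves carry \<open>b\<close> and keep the labels of their parents, so the elements of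
  \<open>S\<close> can be handled one by one.\<close>

lemma extends_labels:
  assumes F: "condition F" and "finite S" "S \<subseteq> F"
  obtains G where "extends F G" "\<And>a w. a \<in> S \<Longrightarrow> w \<in> G - inner G \<Longrightarrow> label a w"
proof -
  have "\<exists>G. extends F G \<and> (\<forall>a\<in>S. \<forall>w\<in>G - inner G. label a w)" using assms(2,3)
  proof (induction S)
    case empty
    then show ?case using extends_refl[OF F] by blast
  next
    case (insert b S)
    then obtain G where G: "extends F G" "\<And>a w. a \<in> S \<Longrightarrow> w \<in> G - inner G \<Longrightarrow> label a w" by blast
    have cG: "condition G" and b: "b \<in> G" using G(1) insert.prems unfolding extends_def by auto
    let ?H = "G \<union> node b ` (G - inner G)"
    have "condition ?H"
    proof (rule conditionI)
      fix a w assume "node a w \<in> ?H"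
      then have "node a w \<in> G \<or> a = b \<and> w \<in> G" by auto
      then show "a \<in> ?H \<and> w \<in> ?H" using conditionD(3,4)[OF cG, of a w] b by blast
    qed (use conditionD(1,2)[OF cG] in simp_all)
    moreover have "?H \<subseteq> future G" using b by (auto intro: future.intros)
    ultimately have "extends G ?H" unfolding extends_def by blast
    moreover have "label a w" if a: "a \<in> insert b S" and w: "w \<in> ?H - inner ?H" for a w
    proof -
      \<comment> \<open>Every leaf of \<open>G\<close> has just received a child, so a leaf of
        \<open>?H\<close> is new.\<close>
      have "w \<notin> G"
      proof
        assume "w \<in> G"
        moreover have "w \<notin> inner G" using w inner_mono[of G ?H] by blast
        ultimately have "node b w \<in> ?H" by blast
        then show False using w unfolding inner_def by blast
      qed
      then obtain v where "w = node b v" "v \<in> G - inner G" using w by blast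
      then show ?thesis using a G(2) by (auto intro: label.intros)
    qed
    ultimately show ?case using extends_trans[OF G(1)] by blast
  qed
  then show ?thesis using that by blast
qed

text \<open>Once the children of inner nodes of \<open>G\<close> are frozen, a path can leave
  \<open>G\<close> only through a leaf, where it has met all of \<open>F\<close>.\<close>

definition covers :: "nat set \<Rightarrow> nat set \<Rightarrow> bool" where
  "covers F G \<longleftrightarrow> (\<forall>a\<in>F. \<forall>w\<in>G - inner G. label a w)"

text \<open>First add a finite member of \<open>S\<close> if one lies in the future of
  \<open>F\<close>; then extend the leaves until they carry every label in \<open>F\<close>.\<close>

lemma generic_step:
  assumes F: "condition F"
  shows "\<exists>G. extends F G \<and> covers F G \<and>
    ((\<exists>D\<in>S. D \<subseteq> G) \<or> (\<forall>D\<in>S. finite D \<longrightarrow> \<not> D \<subseteq> future F))"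
proof -
  obtain H where H: "extends F H" "(\<exists>D\<in>S. D \<subseteq> H) \<or> (\<forall>D\<in>S. finite D \<longrightarrow> \<not> D \<subseteq> future F)"
    using extends_finite[OF F] extends_refl[OF F] by metis
  have cH: "condition H" and FH: "F \<subseteq> H" using H(1) unfolding extends_def by auto
  obtain G where G: "extends H G" "\<And>a w. a \<in> F \<Longrightarrow> w \<in> G - inner G \<Longrightarrow> label a w"
    using extends_labels[OF cH conditionD(1)[OF F] FH] by blast
  have "extends F G" using H(1) G(1) by (rule extends_trans)
  moreover have "H \<subseteq> G" using G(1) unfolding extends_def by blast
  ultimately show ?thesis using H(2) G(2) unfolding covers_def by blast
qed

locale generic_tree =
  fixes F :: "nat \<Rightarrow> nat set" and S :: "nat \<Rightarrow> nat set set"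
  assumes condition_F: "condition (F n)"
    and extends_F: "extends (F n) (F (Suc n))"
    and covers_F: "covers (F n) (F (Suc n))"
    and generic_F: "(\<exists>D\<in>S n. D \<subseteq> F (Suc n)) \<or> (\<forall>D\<in>S n. finite D \<longrightarrow> \<not> D \<subseteq> future (F n))"

lemma generic_tree_exists: obtains F where "generic_tree F S"
proof -
  have "condition {0}" by (rule conditionI) auto
  moreover have "\<exists>G. condition G \<and> extends H G \<and> covers H G \<and>
      ((\<exists>D\<in>S n. D \<subseteq> G) \<or> (\<forall>D\<in>S n. finite D \<longrightarrow> \<not> D \<subseteq> future H))" if "condition H" for H n
    using generic_step[OF that, of "S n"] unfolding extends_def by blast
  ultimately have "\<exists>F. \<forall>n. condition (F n) \<and> extends (F n) (F (Suc n)) \<and> covers (F n) (F (Suc n)) \<and>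
      ((\<exists>D\<in>S n. D \<subseteq> F (Suc n)) \<or> (\<forall>D\<in>S n. finite D \<longrightarrow> \<not> D \<subseteq> future (F n)))"
    by (intro dependent_nat_choice) blast+
  then show ?thesis using that unfolding generic_tree_def by blast
qed

section \<open>The limit tree and the compact set of its paths\<close>

fun branch :: "(nat \<Rightarrow> nat) \<Rightarrow> nat \<Rightarrow> nat" where
  "branch x 0 = 0"
| "branch x (Suc n) = node (x n) (branch x n)"

lemma label_branch: "label a (branch x n) \<longleftrightarrow> (\<exists>i<n. x i = a)"
proof (induction n)
  case 0
  show ?case by (auto elim: label.cases)
next
  case (Suc n)
  have "label a (node b w) \<longleftrightarrow> a = b \<or> label a w" for b w
    by (auto intro: label.intros elim: label.cases)
  then show ?case using Suc by (auto simp: less_Suc_eq)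
qed

lemma strict_mono_branch: "strict_mono (branch x)"
  unfolding strict_mono_Suc_iff using node_greater(2) by simp

context generic_tree
begin

definition T :: "nat set" where
  "T = (\<Union>n. F n)"

definition paths :: "(nat \<Rightarrow> nat) set" where
  "paths = {x. \<forall>n. branch x n \<in> T}"

lemma F_mono: "m \<le> n \<Longrightarrow> F m \<subseteq> F n"
  using lift_Suc_mono_le[of F m n] extends_F unfolding extends_def by blast

lemma T_subset_future: "T \<subseteq> future (F n)"
proof -
  have "future (F (Suc m)) \<subseteq> future (F m)" for m
    using extends_F[of m] unfolding extends_def by (intro future_mono) auto
  then have anti: "m \<le> n \<Longrightarrow> future (F n) \<subseteq> future (F m)" for m n
    by (rule lift_Suc_antimono_le)
  have "F m \<subseteq> future (F n)" for m
  proof -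
    have "F m \<subseteq> F (max m n)" by (intro F_mono) simp
    also have "\<dots> \<subseteq> future (F (max m n))" by (auto intro: future.base)
    also have "\<dots> \<subseteq> future (F n)" by (intro anti) simp
    finally show ?thesis .
  qed
  then show ?thesis unfolding T_def by blast
qed

lemma zero_in_T: "0 \<in> T"
  unfolding T_def using conditionD(2)[OF condition_F] by blast

lemma T_label: assumes "node a w \<in> T" shows "a \<in> T"
proof -
  obtain n where "node a w \<in> F n" using assms unfolding T_def by blast
  then have "a \<in> F n" by (rule conditionD(3)[OF condition_F])
  then show ?thesis unfolding T_def by blast
qed

text \<open>A node \<open>w\<close> of \<open>F n\<close> that is still a leaf at the next stage
  would carry itself as a label, but labels are smaller than the nodes that carry them.\<close>

lemma F_subset_inner: "F n \<subseteq> inner (F (Suc n))"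
proof
  fix w assume w: "w \<in> F n"
  then have "w \<in> F (Suc n)" using F_mono[of n "Suc n"] by auto
  then show "w \<in> inner (F (Suc n))"
    using covers_F[of n] w label_less[of w w] unfolding covers_def by blast
qed

lemma T_child: assumes "w \<in> T" obtains a where "node a w \<in> T"
proof -
  obtain n where "w \<in> F n" using assms unfolding T_def by blast
  then show ?thesis using F_subset_inner[of n] that unfolding inner_def T_def by blast
qed

text \<open>Once a node is inner, its children are frozen, so all of them lie in one finite
  condition.\<close>

lemma finite_children: assumes "w \<in> T" shows "finite {a. node a w \<in> T}"
proof -
  obtain n where "w \<in> F n" using assms unfolding T_def by blast
  then have "w \<in> inner (F (Suc n))" using F_subset_inner by blast
  then have "(\<lambda>a. node a w) ` {a. node a w \<in> T} \<subseteq> F (Suc n)"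
    using T_subset_future[of "Suc n"] by (auto intro: future_frozen)
  then have "finite ((\<lambda>a. node a w) ` {a. node a w \<in> T})"
    using conditionD(1)[OF condition_F] finite_subset by blast
  then show ?thesis by (rule finite_imageD) (auto intro: inj_onI)
qed

lemma infinite_T: "infinite T"
proof
  assume fin: "finite T"
  then have "Max T \<in> T" using zero_in_T by (intro Max_in) auto
  then obtain a where "node a (Max T) \<in> T" using T_child by blast
  then show False using Max_ge[OF fin] node_greater(2)[of "Max T" a] by (meson not_le)
qed

text \<open>The maximum of \<open>F n\<close> is a leaf, because a child would be larger. In the
  future of \<open>F n\<close> every element labels a child of it, while in \<open>T\<close> it has
  finitely many children.\<close>

lemma T_neq_future: "T \<noteq> future (F n)"
proof
  assume T: "T = future (F n)"
  have fin: "finite (F n)" and ne: "F n \<noteq> {}" using conditionD(1,2)[OF condition_F] by blast+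
  let ?w = "Max (F n)"
  have w: "?w \<in> F n" using fin ne by (rule Max_in)
  have "?w \<notin> inner (F n)"
    using Max_ge[OF fin] node_greater(2) unfolding inner_def by (auto simp: not_le[symmetric])
  then have "T \<subseteq> {a. node a ?w \<in> T}"
    using w unfolding T by (auto intro: future.intros)
  moreover have "?w \<in> T" using w unfolding T_def by blast
  ultimately show False using finite_children infinite_T finite_subset by blast
qed

text \<open>One inclusion is closure under labels. Conversely, if \<open>a\<close> is in
  \<open>F n\<close>, the path has to leave the finite set \<open>F (Suc n)\<close>, and the leaf
  through which it leaves carries \<open>a\<close>.\<close>

lemma range_path: assumes x: "x \<in> paths" shows "range x = T"
proof
  have T: "branch x n \<in> T" for n using x unfolding paths_def by blast
  show "range x \<subseteq> T"
  proof
    fix a assume "a \<in> range x"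
    then obtain n where "a = x n" by blast
    then have "node a (branch x n) \<in> T" using T[of "Suc n"] by simp
    then show "a \<in> T" by (rule T_label)
  qed
  show "T \<subseteq> range x"
  proof
    fix a assume "a \<in> T"
    then obtain n where a: "a \<in> F n" unfolding T_def by blast
    let ?G = "F (Suc n)"
    have "\<exists>m. branch x m \<notin> ?G"
    proof (rule ccontr)
      assume "\<nexists>m. branch x m \<notin> ?G"
      then have "range (branch x) \<subseteq> ?G" by blast
      moreover have "infinite (range (branch x))"
        using strict_mono_branch strict_mono_imp_inj_on by (metis finite_imageD infinite_UNIV_nat)
      ultimately show False using conditionD(1)[OF condition_F] finite_subset by blast
    qed
    then have out: "branch x (LEAST m. branch x m \<notin> ?G) \<notin> ?G" by (rule LeastI_ex)
    moreover have "branch x 0 \<in> ?G" using conditionD(2)[OF condition_F] by simp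
    ultimately obtain m where m: "(LEAST m. branch x m \<notin> ?G) = Suc m" by (metis not0_implies_Suc)
    have "branch x m \<in> ?G" using not_less_Least[of m "\<lambda>m. branch x m \<notin> ?G"] m by simp
    \<comment> \<open>If this node were frozen, the next node of the path would still be in
      \<open>?G\<close>.\<close>
    moreover have "branch x m \<notin> inner ?G"
    proof
      assume "branch x m \<in> inner ?G"
      moreover have "node (x m) (branch x m) \<in> future ?G"
        using T[of "Suc m"] T_subset_future by auto
      ultimately show False using out m future_frozen by simp
    qed
    ultimately have "label a (branch x m)" using covers_F[of n] a unfolding covers_def by blast
    then show "a \<in> range x" unfolding label_branch by blast
  qed
qed

text \<open>Finite branching makes each level finite, and the node on level \<open>Suc n\<close>
  determines \<open>x n\<close>.\<close>

lemma finite_values: "finite ((\<lambda>x. x n) ` paths)"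
proof -
  have level: "finite ((\<lambda>x. branch x n) ` paths)" for n
  proof (induction n)
    case (Suc n)
    have "(\<lambda>x. branch x (Suc n)) ` paths \<subseteq>
        (\<Union>w\<in>(\<lambda>x. branch x n) ` paths. (\<lambda>a. node a w) ` {a. node a w \<in> T})"
      unfolding paths_def by (auto simp: image_iff) (metis branch.simps(2))
    moreover have "finite \<dots>"
      using Suc
    proof (rule finite_UN_I)
      fix w assume "w \<in> (\<lambda>x. branch x n) ` paths"
      then have "w \<in> T" unfolding paths_def by blast
      then show "finite ((\<lambda>a. node a w) ` {a. node a w \<in> T})"
        by (intro finite_imageI finite_children)
    qed
    ultimately show ?case by (rule finite_subset)
  qed (auto intro: finite_subset[of _ "{0}"])
  have "(\<lambda>x. x n) ` paths \<subseteq> (\<lambda>z. fst (prod_decode (z - 1))) ` (\<lambda>x. branch x (Suc n)) ` paths"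
    by (auto simp: node_def image_iff intro!: bexI)
  then show ?thesis using level finite_subset by blast
qed

lemma closed_paths: "closed paths"
proof -
  have op: "open {x. branch x n = w}" for n w
  proof (induction n arbitrary: w)
    case 0
    show ?case by (cases "w = 0") auto
  next
    case (Suc n)
    have "open ((\<lambda>x. x n) -` {a} :: (nat \<Rightarrow> nat) set)" for a
      by (rule open_vimage) (auto intro: continuous_intros open_discrete)
    then have "open (\<Union>(a, v)\<in>{(a, v). w = node a v}. (\<lambda>x. x n) -` {a} \<inter> {x. branch x n = v})"
      using Suc by (intro open_UN) auto
    moreover have "{x. branch x (Suc n) = w} =
        (\<Union>(a, v)\<in>{(a, v). w = node a v}. (\<lambda>x. x n) -` {a} \<inter> {x. branch x n = v})" by auto
    ultimately show ?case by simp
  qed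
  have "- paths = (\<Union>n. \<Union>w\<in>- T. {x. branch x n = w})" unfolding paths_def by auto
  also have "open \<dots>" by (intro open_UN ballI op)
  finally show ?thesis by (simp add: closed_def)
qed

text \<open>A closed subset of a product of finite sets, which is compact by Tychonoff's
  theorem.\<close>

lemma compact_paths: "compact paths"
proof -
  let ?K = "\<lambda>n. (\<lambda>x. x n) ` paths"
  have "compactin (product_topology (\<lambda>_. euclidean) UNIV) (PiE UNIV ?K)"
    unfolding compactin_PiE using finite_values by (auto intro: finite_imp_compact)
  then have "compact (PiE UNIV ?K)"
    by (simp add: euclidean_product_topology)
  then have "compact (PiE UNIV ?K \<inter> paths)" using closed_paths by (rule compact_Int_closed)
  moreover have "PiE UNIV ?K \<inter> paths = paths" by auto
  ultimately show ?thesis by simp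
qed

end

section \<open>Computability properties of the generic tree\<close>

lemma prod_decode_le: "fst (prod_decode z) \<le> z" "snd (prod_decode z) \<le> z"
  using le_prod_encode_1[of "fst (prod_decode z)" "snd (prod_decode z)"]
    le_prod_encode_2[of "snd (prod_decode z)" "fst (prod_decode z)"] by simp_all

text \<open>Rebuilds a node from its retracted parts and falls back to the root when a frozen node
  would get a new child. Applied to the entries of arbitrary codes, it confines a search to oracles
  with values in \<open>future F\<close>.\<close>

function retract :: "nat set \<Rightarrow> nat \<Rightarrow> nat" where
  "retract F 0 = 0"
| "retract F (Suc z) = (if Suc z \<in> F then Suc z
     else if retract F (snd (prod_decode z)) \<in> inner F then 0
     else node (retract F (fst (prod_decode z))) (retract F (snd (prod_decode z))))"
  by pat_completeness auto
termination
  by (relation "measure snd") (auto simp: less_Suc_eq_le prod_decode_le)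

declare retract.simps(2) [simp del]

lemma retract_in_future:
  assumes "0 \<in> F" shows "retract F z \<in> future F"
  using assms
proof (induction F z rule: retract.induct)
  case (1 F)
  then show ?case by (simp add: future.base)
next
  case (2 F z)
  then show ?case by (auto simp: retract.simps(2) intro: future.intros)
qed

lemma retract_fixed: "w \<in> future F \<Longrightarrow> retract F w = w"
proof (induction rule: future.induct)
  case (base w)
  then show ?case by (cases w) (auto simp: retract.simps(2))
next
  case (child w a)
  then show ?case by (simp add: retract.simps(2) node_def)
qed

lemma recursive_retract:
  assumes F: "condition F" shows "recursive (retract F)"
proof -
  \<comment> \<open>Course-of-values recursion: \<open>?table k\<close> lists the values at
    \<open>k\<close> down to \<open>0\<close>, so position \<open>k - j\<close> holds the value at
    \<open>j\<close>. \<open>val k\<close> is the value at \<open>Suc k\<close>.\<close>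
  define val where "val k t = (if Suc k \<in> F then Suc k
      else if lookup t (k - snd (prod_decode k)) \<in> inner F then 0
      else node (lookup t (k - fst (prod_decode k))) (lookup t (k - snd (prod_decode k))))" for k t
  let ?table = "rec_nat 0 (\<lambda>k t. prod_encode (val k t, t))"
  have zero: "lookup 0 0 = 0"
    using lookup_prod_encode(1)[of 0 0] by (simp add: prod_encode_def)
  have table: "j \<le> k \<Longrightarrow> lookup (?table k) j = retract F (k - j)" for j k
  proof (induction k arbitrary: j)
    case 0
    then show ?case by (simp add: zero)
  next
    case (Suc k)
    have "lookup (?table k) (k - fst (prod_decode k)) = retract F (fst (prod_decode k))"
      "lookup (?table k) (k - snd (prod_decode k)) = retract F (snd (prod_decode k))"
      using prod_decode_le[of k] by (simp_all add: Suc.IH)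
    then have "val k (?table k) = retract F (Suc k)"
      unfolding val_def[of k "?table k"] retract.simps(2) by simp
    then show ?case using Suc by (cases j) auto
  qed
  have fin: "finite F" "finite (inner F)"
    using conditionD(1)[OF F] finite_subset[of "inner F" F] conditionD(4)[OF F]
    by (auto simp: inner_def)
  have "computable_on (\<lambda>f _. f = (\<lambda>_. 0)) 1 (\<lambda>f xs. lookup (?table (xs ! 0)) 0)"
    unfolding val_def node_def
    by (intro computable_on_lookup computable_on_rec_nat computable_on_prod_encode
        computable_on_If decidable_on_finite fin computable_on_Suc computable_on_diff
        computable_on_fst computable_on_snd computable_on_const computable_on_nth) simp_all
  then have "computable_on (\<lambda>f _. f = (\<lambda>_. 0)) 1 (\<lambda>f xs. retract F (xs ! 0))"
    by (simp add: table)
  then show ?thesis by (rule recursive_if_computable_on)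
qed

section \<open>From enumeration reducibility to Medvedev reducibility\<close>

lemma medvedev_reducible_if_computable_on:
  assumes "computable_on (\<lambda>f _. f \<in> \<B>) 1 (\<lambda>f xs. G f (xs ! 0))" "\<And>f. f \<in> \<B> \<Longrightarrow> G f \<in> \<A>"
  shows "\<A> \<le>\<^sub>s \<B>"
proof -
  obtain p where p: "\<And>f xs. length xs = 1 \<Longrightarrow> f \<in> \<B> \<Longrightarrow> computes f p xs (G f (xs ! 0))"
    using assms(1) unfolding computable_on_def by blast
  have "computes f p [n] (G f n)" if "f \<in> \<B>" for f n using p[of "[n]" f] that by simp
  then show ?thesis unfolding medvedev_reducible_def using assms(2) by blast
qed

lemma set_decode_less: "x \<in> set_decode d \<Longrightarrow> x < d"
proof -
  assume "x \<in> set_decode d"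
  then have "odd (d div 2 ^ x)" by (simp add: set_decode_def)
  then have "d div 2 ^ x \<noteq> 0" by (metis even_zero)
  then have "2 ^ x \<le> d" by (simp add: div_eq_0_iff not_less)
  then show "x < d" using less_exp[of x] by linarith
qed

text \<open>Given an enumeration of \<open>A\<close>, search for an element of \<open>W\<close> that
  proposes a value at \<open>n\<close> and whose finite set has already appeared. Any such proposal
  belongs to the graph and is therefore correct.\<close>

lemma singleton_reducible_if_graph_reducible:
  assumes "graph g \<le>\<^sub>e A" shows "{g} \<le>\<^sub>s \<E> A"
proof -
  obtain W where W: "re W"
    "\<And>x. x \<in> graph g \<longleftrightarrow> (\<exists>D. finite D \<and> D \<subseteq> A \<and> prod_encode (x, set_encode D) \<in> W)"
    using assms unfolding enum_reducible_def by blast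
  have in_graph: "x \<in> graph g \<longleftrightarrow> snd (prod_decode x) = g (fst (prod_decode x))" for x
    unfolding graph_def by (auto simp: prod_decode_eq[symmetric] simp del: prod_decode_eq)
      (metis prod.collapse prod_decode_inverse)
  have "prod_encode (0, g 0) \<in> graph g" by (simp add: in_graph)
  then have "W \<noteq> {}" using W(2) by blast
  then obtain w where w: "recursive w" "range w = W" using W(1) unfolding re_def by blast
  define elem where "elem m = fst (prod_decode (w (fst (prod_decode m))))" for m
  define use where "use m = snd (prod_decode (w (fst (prod_decode m))))" for m
  \<comment> \<open>\<open>m\<close> codes the index of an element of \<open>W\<close> and the
    length of the initial segment of \<open>f\<close> to inspect. Elements of a coded set are below
    its code, which bounds the quantifier.\<close>
  define found where "found f n m \<longleftrightarrow> fst (prod_decode (elem m)) = n \<and>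
    (\<forall>x<use m. x \<in> set_decode (use m) \<longrightarrow> (\<exists>j<snd (prod_decode m). f j = x))" for f n m
  have ex: "\<exists>m. found f n m" if f: "f \<in> \<E> A" for f n
  proof -
    have "prod_encode (n, g n) \<in> graph g" by (simp add: in_graph)
    then obtain D where D: "finite D" "D \<subseteq> A" "prod_encode (prod_encode (n, g n), set_encode D) \<in> W"
      using W(2) by blast
    then obtain i where i: "w i = prod_encode (prod_encode (n, g n), set_encode D)"
      using w(2) by (metis rangeE)
    obtain J where J: "finite J" "D = f ` J"
      using finite_subset_image[OF D(1), of f UNIV] D(2) f unfolding enumerations_def by auto
    obtain k where "\<forall>j\<in>J. j < k" using J(1) finite_nat_set_iff_bounded by blast
    then have "found f n (prod_encode (i, k))"
      using J D(1) i by (auto simp: found_def elem_def use_def)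
    then show ?thesis by blast
  qed
  have val: "snd (prod_decode (elem m)) = g n" if f: "f \<in> \<E> A" and m: "found f n m" for f n m
  proof -
    have "set_decode (use m) \<subseteq> range f"
      using m set_decode_less unfolding found_def by blast
    moreover have "prod_encode (elem m, set_encode (set_decode (use m))) \<in> W"
      using w(2) by (auto simp: elem_def use_def)
    ultimately have "elem m \<in> graph g"
      using W(2) f finite_set_decode unfolding enumerations_def by blast
    then show ?thesis using m unfolding in_graph found_def by simp
  qed
  have "computable_on (\<lambda>f _. f \<in> \<E> A) 1 (\<lambda>f xs. snd (prod_decode (elem (LEAST m. found f (xs ! 0) m))))"
    unfolding found_def elem_def use_def
    by (intro computable_on_fst computable_on_snd computable_on_recursive[OF w(1)]
        computable_on_Least decidable_on_conj decidable_on_eq decidable_on_all_less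
        decidable_on_imp decidable_on_set_decode decidable_on_ex_less computable_on_oracle
        computable_on_nth)
      (use ex in \<open>simp_all add: found_def elem_def use_def computable_intros
         computable_on_fst computable_on_snd computable_on_recursive[OF w(1)]\<close>)
  then show ?thesis
    by (rule medvedev_reducible_if_computable_on)
      (use val LeastI_ex[OF ex] in \<open>auto simp: fun_eq_iff\<close>)
qed

text \<open>The witness pairs each \<open>x\<close> with the code \<open>2 ^ x\<close> of
  \<open>{x}\<close>.\<close>

lemma enum_reducible_refl: "A \<le>\<^sub>e A"
proof -
  let ?h = "\<lambda>x::nat. prod_encode (x, 2 ^ x)"
  have "recursive ?h"
    by (intro recursive_if_computable_on computable_on_prod_encode computable_on_power_two
        computable_on_nth) simp_all
  then have "re (range ?h)" unfolding re_def by blast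
  moreover have "set_encode {x} = 2 ^ x" for x by (simp add: set_encode_def)
  then have "prod_encode (x, set_encode D) \<in> range ?h \<longleftrightarrow> D = {x}" if "finite D" for x D
    using that set_encode_eq[of D "{x}"] by auto
  then have "x \<in> A \<longleftrightarrow> (\<exists>D. finite D \<and> D \<subseteq> A \<and> prod_encode (x, set_encode D) \<in> range ?h)" for x
    by (metis finite.emptyI finite.insertI insert_subset empty_subsetI)
  ultimately show ?thesis unfolding enum_reducible_def by blast
qed

section \<open>Finite prefixes of enumerations and the requirements on the tree\<close>

lemma enumeration_with_prefix:
  assumes "A \<noteq> {}" "g ` {..<k} \<subseteq> A" obtains f where "f \<in> \<E> A" "\<forall>i<k. f i = g i"
proof -
  let ?f = "\<lambda>i. if i < k then g i else from_nat_into A (i - k)"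
  have "range ?f = A"
  proof
    show "range ?f \<subseteq> A" using assms(2) from_nat_into[OF assms(1)] by auto
    show "A \<subseteq> range ?f"
    proof
      fix a assume "a \<in> A"
      then have "?f (to_nat_on A a + k) = a" by (simp add: from_nat_into_to_nat_on)
      then show "a \<in> range ?f" by (rule range_eqI[OF sym])
    qed
  qed
  then show ?thesis using that[of ?f] by (simp add: enumerations_def)
qed

text \<open>If such a set lies in \<open>T\<close>, both finite sequences extend to enumerations of
  \<open>T\<close> on which \<open>p\<close> gives different results.\<close>

definition conflicts :: "prog \<Rightarrow> nat set set" where
  "conflicts p = {g ` {..<k} \<union> g' ` {..<k} | g g' k.
     \<exists>x y y'. y \<noteq> y' \<and> (\<forall>f. (\<forall>i<k. f i = g i) \<longrightarrow> computes f p [x] y) \<and>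
       (\<forall>f. (\<forall>i<k. f i = g' i) \<longrightarrow> computes f p [x] y')}"

lemma conflictsE:
  assumes "D \<in> conflicts p"
  obtains g g' k x y y' where "D = g ` {..<k} \<union> g' ` {..<k}" "y \<noteq> y'"
    "\<forall>f. (\<forall>i<k. f i = g i) \<longrightarrow> computes f p [x] y" "\<forall>f. (\<forall>i<k. f i = g' i) \<longrightarrow> computes f p [x] y'"
  using assms unfolding conflicts_def mem_Collect_eq by (elim exE conjE) (rule that)

lemma conflictsI:
  assumes "y \<noteq> y'" "\<And>f. \<forall>i<k. f i = g i \<Longrightarrow> computes f p [x] y"
    "\<And>f. \<forall>i<k. f i = g' i \<Longrightarrow> computes f p [x] y'"
  shows "g ` {..<k} \<union> g' ` {..<k} \<in> conflicts p"
  unfolding conflicts_def mem_Collect_eq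
  by (rule exI[of _ g], rule exI[of _ g'], rule exI[of _ k], rule conjI[OF refl], rule exI[of _ x],
      rule exI[of _ y], rule exI[of _ y'], intro conjI allI impI assms) simp_all

text \<open>Putting a member into \<open>T\<close> gives \<open>T\<close> an element that
  \<open>p\<close> does not enumerate.\<close>

definition escapes :: "prog \<Rightarrow> nat set set" where
  "escapes p = {{w} | w. \<nexists>n. computes (\<lambda>_. 0) p [n] w}"

locale fully_generic_tree = generic_tree +
  assumes conflicts_S: "\<exists>n. S n = conflicts p" and escapes_S: "\<exists>n. S n = escapes p"

lemma fully_generic_tree_exists: obtains F S where "fully_generic_tree F S"
proof -
  let ?X = "range conflicts \<union> range escapes"
  have X: "countable ?X" by simp
  obtain F where "generic_tree F (from_nat_into ?X)" using generic_tree_exists by blast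
  moreover have "\<exists>n. from_nat_into ?X n = D" if "D \<in> ?X" for D
    using from_nat_into_surj[OF X that] .
  ultimately have "fully_generic_tree F (from_nat_into ?X)"
    unfolding fully_generic_tree_def fully_generic_tree_axioms_def by blast
  then show ?thesis by (rule that)
qed

section \<open>Enumerations of the tree compute its paths\<close>

context generic_tree
begin

text \<open>Starting at the root, move to the first child of the current node that is
  enumerated.\<close>

lemma paths_reducible: "paths \<le>\<^sub>s \<E> T"
proof -
  define child where "child f w = f (LEAST i. \<not> f i = 0 \<and> snd (prod_decode (f i - 1)) = w)"
    for f :: "nat \<Rightarrow> nat" and w
  define x where "x f n = fst (prod_decode (rec_nat 0 (\<lambda>_. child f) (Suc n) - 1))" for f n
  have ex: "\<exists>i. \<not> f i = 0 \<and> snd (prod_decode (f i - 1)) = w" if f: "f \<in> \<E> T" and w: "w \<in> T" for f w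
  proof -
    obtain a where "node a w \<in> range f" using T_child[OF w] f unfolding enumerations_def by blast
    then obtain i where "f i = node a w" by (metis rangeE)
    then have "\<not> f i = 0 \<and> snd (prod_decode (f i - 1)) = w" by (simp add: node_def)
    then show ?thesis by blast
  qed
  have child_node: "child f w = node (fst (prod_decode (child f w - 1))) w" if "f \<in> \<E> T" "w \<in> T" for f w
  proof -
    have "\<not> child f w = 0 \<and> snd (prod_decode (child f w - 1)) = w"
      unfolding child_def using LeastI_ex[OF ex[OF that]] .
    then show ?thesis using node_decode[of "child f w - 1"] by simp
  qed
  have run: "rec_nat 0 (\<lambda>_. child f) n \<in> T \<and> branch (x f) n = rec_nat 0 (\<lambda>_. child f) n"
    if f: "f \<in> \<E> T" for f n
  proof (induction n)
    case 0
    show ?case using zero_in_T by simp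
  next
    case (Suc n)
    have "child f w \<in> T" for w using f unfolding child_def enumerations_def by blast
    then show ?case using Suc child_node[OF f, of "rec_nat 0 (\<lambda>_. child f) n"] by (simp add: x_def)
  qed
  have "computable_on (\<lambda>f _. f \<in> \<E> T) 1 (\<lambda>f xs. x f (xs ! 0))"
    unfolding x_def
  proof (intro computable_on_fst computable_on_diff computable_on_rec_nat computable_on_const
        computable_on_Suc computable_on_nth)
    \<comment> \<open>The search for a child is guaranteed to succeed at nodes of \<open>T\<close>,
      and the recursion started at \<open>0\<close> stays in \<open>T\<close>.\<close>
    have "computable_on (\<lambda>f zs. f \<in> \<E> T \<and> zs ! 1 \<in> T) (Suc (Suc 1)) (\<lambda>f zs. child f (zs ! 1))"
      unfolding child_def
      by (intro computable_on_oracle computable_on_Least decidable_on_conj decidable_on_not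
          decidable_on_eq computable_on_snd computable_on_diff computable_on_const
          computable_on_nth computable_on_nth_drop) (use ex in simp_all)
    then show "computable_on (\<lambda>f zs. f \<in> \<E> T \<and> zs ! 1 = rec_nat 0 (\<lambda>_. child f) (zs ! 0)) (Suc (Suc 1))
        (\<lambda>f zs. child f (zs ! 1))"
      by (rule computable_on_mono) (use run in simp)
  qed simp
  then show ?thesis
    by (rule medvedev_reducible_if_computable_on) (use run in \<open>simp add: paths_def\<close>)
qed

lemma equivalent_paths: "\<E> T \<equiv>\<^sub>s paths"
proof -
  have "\<E> T \<le>\<^sub>s paths"
    unfolding medvedev_reducible_def enumerations_def
    using range_path by (blast intro: computes.query)
  then show ?thesis using paths_reducible unfolding medvedev_equivalent_def by blast
qed

end

section \<open>Quasiminimality of the tree\<close>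

context fully_generic_tree
begin

text \<open>If \<open>p\<close> enumerates \<open>T\<close>, then \<open>escapes p\<close> consists
  of the singletons outside \<open>T\<close>, and none of them enters \<open>T\<close>. Genericity
  then forces \<open>T = future (F n)\<close>.\<close>

lemma not_re: "\<not> re T"
proof
  assume "re T"
  then obtain h where h: "recursive h" "range h = T" using zero_in_T unfolding re_def by blast
  obtain p where p: "\<And>n. computes (\<lambda>_. 0) p [n] (h n)" using h(1) unfolding recursive_iff by blast
  have "(\<exists>n. computes (\<lambda>_. 0) p [n] w) \<longleftrightarrow> w \<in> T" for w
    using p h(2) computes_deterministic[OF _ p] by (metis rangeE rangeI)
  then have esc: "escapes p = {{w} | w. w \<notin> T}" unfolding escapes_def by simp
  obtain n where n: "S n = escapes p" using escapes_S by blast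
  have "\<not> (\<exists>D\<in>S n. D \<subseteq> F (Suc n))" unfolding n esc T_def by blast
  then have avoid: "\<forall>D\<in>S n. finite D \<longrightarrow> \<not> D \<subseteq> future (F n)" using generic_F[of n] by blast
  have "w \<notin> future (F n)" if "w \<notin> T" for w
  proof -
    have "{w} \<in> S n" using that unfolding n esc by blast
    from bspec[OF avoid this] show ?thesis by simp
  qed
  then show False using T_subset_future[of n] T_neq_future[of n] by blast
qed

text \<open>A conflict inside \<open>T\<close> contradicts the reduction, so by genericity no finite
  conflict lies in \<open>future (F n)\<close>. Hence every halting computation with oracle values
  there gives the right result, and some such computation halts.\<close>

lemma recursive_if_singleton_reducible:
  assumes "{f} \<le>\<^sub>s \<E> T" shows "recursive f"
proof -
  obtain p where p: "\<And>g n. g \<in> \<E> T \<Longrightarrow> computes g p [n] (f n)"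
    using assms unfolding medvedev_reducible_def by blast
  have T: "T \<noteq> {}" using zero_in_T by blast
  obtain n where n: "S n = conflicts p" using conflicts_S by blast
  let ?B = "future (F n)"
  have "\<not> (\<exists>D\<in>S n. D \<subseteq> F (Suc n))"
  proof
    assume "\<exists>D\<in>S n. D \<subseteq> F (Suc n)"
    then obtain D where D: "D \<in> conflicts p" "D \<subseteq> T" unfolding n T_def by blast
    from D(1) obtain g g' k x y y' where yy: "D = g ` {..<k} \<union> g' ` {..<k}" "y \<noteq> y'"
      "\<forall>f. (\<forall>i<k. f i = g i) \<longrightarrow> computes f p [x] y" "\<forall>f. (\<forall>i<k. f i = g' i) \<longrightarrow> computes f p [x] y'"
      by (rule conflictsE)
    have gT: "g ` {..<k} \<subseteq> T" "g' ` {..<k} \<subseteq> T" using yy(1) D(2) by blast+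
    obtain e where "e \<in> \<E> T" "\<forall>i<k. e i = g i" by (rule enumeration_with_prefix[OF T gT(1)])
    then have "y = f x" by (intro computes_deterministic[OF mp[OF spec[OF yy(3)]] p])
    moreover obtain e' where "e' \<in> \<E> T" "\<forall>i<k. e' i = g' i" by (rule enumeration_with_prefix[OF T gT(2)])
    then have "y' = f x" by (intro computes_deterministic[OF mp[OF spec[OF yy(4)]] p])
    ultimately show False using yy(2) by simp
  qed
  then have free: "\<not> D \<subseteq> ?B" if "D \<in> conflicts p" "finite D" for D
    using generic_F[of n] that unfolding n by blast
  have zero: "0 \<in> F n" by (rule conditionD(2)[OF condition_F])
  define orc where "orc c i = retract (F n) (lookup c i)" for c i
  have orc_range: "orc c i \<in> ?B" for c i unfolding orc_def by (rule retract_in_future[OF zero])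
  have val: "y = f x" if y: "computes (orc c) p [x] y" for c x y
  proof (rule ccontr)
    assume ne: "y \<noteq> f x"
    obtain e where e: "e \<in> \<E> T" using enumeration_with_prefix[OF T, of _ 0] by auto
    obtain k where k: "\<And>g. (\<forall>i<k. g i = e i) \<Longrightarrow> computes g p [x] (f x)"
      using computes_use[OF p[OF e]] by blast
    obtain l where l: "\<And>g. (\<forall>i<l. g i = orc c i) \<Longrightarrow> computes g p [x] y"
      using computes_use[OF y] by blast
    let ?m = "max k l"
    have "e ` {..<?m} \<union> orc c ` {..<?m} \<in> conflicts p"
    proof (rule conflictsI[of "f x" y ?m e p x])
      show "f x \<noteq> y" using ne by simp
    qed (use k l in simp_all)
    moreover have "e ` {..<?m} \<union> orc c ` {..<?m} \<subseteq> ?B"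
      using e T_subset_future[of n] orc_range unfolding enumerations_def by auto
    ultimately show False using free by blast
  qed
  have ex: "\<exists>c. computes (orc c) p [x] (f x)" for x
  proof -
    obtain e where e: "e \<in> \<E> T" using enumeration_with_prefix[OF T, of _ 0] by auto
    obtain k where k: "\<And>g. (\<forall>i<k. g i = e i) \<Longrightarrow> computes g p [x] (f x)"
      using computes_use[OF p[OF e]] by blast
    obtain c where c: "\<forall>i<k. lookup c i = e i" using lookup_surj by blast
    have "e i \<in> ?B" for i using e T_subset_future[of n] unfolding enumerations_def by blast
    then have "\<forall>i<k. orc c i = e i" using c by (simp add: orc_def retract_fixed)
    then show ?thesis using k by blast
  qed
  \<comment> \<open>\<open>m\<close> codes a search cutoff together with an oracle.\<close>
  let ?run = "\<lambda>x m. eval_upto (fst (prod_decode m)) (orc (snd (prod_decode m))) p [x]"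
  have halts: "\<exists>m. \<not> ?run x m = 0" for x
  proof -
    obtain c where "computes (orc c) p [x] (f x)" using ex by blast
    then obtain s where "eval_upto s (orc c) p [x] = Suc (f x)"
      using eventually_happens'[OF _ eval_upto_complete] by fastforce
    then have "\<not> ?run x (prod_encode (s, c)) = 0" by simp
    then show ?thesis by blast
  qed
  have f: "?run x (LEAST m. \<not> ?run x m = 0) - 1 = f x" for x
  proof -
    have "\<not> ?run x (LEAST m. \<not> ?run x m = 0) = 0" by (rule LeastI_ex[OF halts])
    then obtain y where "?run x (LEAST m. \<not> ?run x m = 0) = Suc y" using not0_implies_Suc by blast
    then show ?thesis using eval_upto_sound val by fastforce
  qed
  have orc: "computable_on D k (\<lambda>f xs. orc (C f xs) (I f xs))"
    if "computable_on D k C" "computable_on D k I" for D k C I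
    unfolding orc_def 
    by (rule computable_on_recursive[OF recursive_retract[OF condition_F] computable_on_lookup[OF that]])
  have run: "computable_on D k (\<lambda>f xs. ?run (X f xs) (M f xs))"
    if "computable_on D k X" "computable_on D k M" for D k X M
  proof -
    have "computable_on D k (\<lambda>f xs. eval_upto (fst (prod_decode (M f xs)))
        (orc (snd (prod_decode (M f xs)))) p (map (\<lambda>G. G f xs) [X]))"
    proof (rule computable_on_eval_upto)
      show "computable_on D k (\<lambda>f xs. fst (prod_decode (M f xs)))"
        by (rule computable_on_fst[OF that(2)])
      show "computable_on D k (\<lambda>f xs. snd (prod_decode (M f xs)))"
        by (rule computable_on_snd[OF that(2)])
      show "computable_on D k G" if "G \<in> set [X]" for G
        using \<open>computable_on D k X\<close> that by simp
    qed (rule orc)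
    then show ?thesis by simp
  qed
  have "computable_on (\<lambda>f _. f = (\<lambda>_. 0)) 1
      (\<lambda>_ xs. ?run (xs ! 0) (LEAST m. \<not> ?run (xs ! 0) m = 0) - 1)"
    by (intro computable_on_diff run computable_on_Least decidable_on_not decidable_on_zero
        computable_on_nth computable_on_nth_drop computable_on_const halts) simp_all
  then show ?thesis unfolding f by (rule recursive_if_computable_on)
qed

lemma quasiminimal_T: "quasiminimal T"
  unfolding quasiminimal_def
  using not_re recursive_if_singleton_reducible singleton_reducible_if_graph_reducible by blast

end

theorem theorem19:
  "\<exists>A :: nat set. A \<noteq> {} \<and> quasiminimal_enum_degree A \<and>
     (\<exists>C :: (nat \<Rightarrow> nat) set. compact C \<and> \<E> A \<equiv>\<^sub>s C) \<and>
     closed_degree (deg\<^sub>s (\<E> A)) \<and>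
     nonzero_degree (deg\<^sub>s (\<E> A)) \<and>
     \<not> (\<exists>\<d>. degree_of_solvability \<d> \<and> nonzero_degree \<d> \<and> deg_le \<d> (deg\<^sub>s (\<E> A))) \<and>
     \<not> (\<exists>f :: nat \<Rightarrow> nat. \<not> recursive f \<and> {f} \<le>\<^sub>s \<E> A)"
proof -
  obtain F S where "fully_generic_tree F S" by (rule fully_generic_tree_exists)
  then interpret fully_generic_tree F S .
  have nonzero: "nonzero_degree (deg\<^sub>s (\<E> T))"
    unfolding nonzero_degree_def deg\<^sub>s_def
  proof (intro ballI notI)
    fix \<A> assume "\<A> \<in> {\<B>. \<B> \<equiv>\<^sub>s \<E> T}" "\<exists>f\<in>\<A>. recursive f"
    then obtain f where f: "f \<in> \<A>" "recursive f" and "\<E> T \<le>\<^sub>s \<A>"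
      unfolding medvedev_equivalent_def by blast
    then obtain p g where "g \<in> \<E> T" "\<And>n. computes f p [n] (g n)"
      unfolding medvedev_reducible_def by blast
    then have "re T" using recursive_relative[OF f(2)] unfolding enumerations_def re_def by blast
    then show False using not_re by blast
  qed
  have no_solvability: "\<not> (\<exists>\<d>. degree_of_solvability \<d> \<and> nonzero_degree \<d> \<and> deg_le \<d> (deg\<^sub>s (\<E> T)))"
  proof
    assume "\<exists>\<d>. degree_of_solvability \<d> \<and> nonzero_degree \<d> \<and> deg_le \<d> (deg\<^sub>s (\<E> T))"
    then obtain f where f: "nonzero_degree (deg\<^sub>s {f})" "deg_le (deg\<^sub>s {f}) (deg\<^sub>s (\<E> T))"
      unfolding degree_of_solvability_def by blast
    have "{f} \<in> deg\<^sub>s {f}"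
      unfolding deg\<^sub>s_def medvedev_equivalent_def using medvedev_reducible_refl by blast
    then have "\<not> recursive f" using f(1) unfolding nonzero_degree_def by blast
    \<comment> \<open>The reduction between representatives of the two degrees is carried to
      \<open>{f}\<close> and \<open>\<E> T\<close> by transitivity.\<close>
    moreover have "{f} \<le>\<^sub>s \<E> T"
      using f(2) medvedev_reducible_trans
      unfolding deg_le_def deg\<^sub>s_def medvedev_equivalent_def by blast
    ultimately show False using recursive_if_singleton_reducible by blast
  qed
  have "quasiminimal_enum_degree T"
    unfolding quasiminimal_enum_degree_def enum_equivalent_def
    using quasiminimal_T enum_reducible_refl by blast
  moreover have "closed_degree (deg\<^sub>s (\<E> T))"
    unfolding closed_degree_def deg\<^sub>s_def
    using closed_paths equivalent_paths unfolding medvedev_equivalent_def by blast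
  ultimately show ?thesis
    using nonzero no_solvability zero_in_T compact_paths equivalent_paths
      recursive_if_singleton_reducible
    by (intro exI[of _ T]) blast
qed

end
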